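(* We have $M=M_{\mathrm{loc}}=\Gamma$ whenever $\Gamma$ is an equilateral pumpkin graph or an equilateral complete graph with $V\ge 3$ vertices.
   Context: A metric graph $\Gamma$ is given by a finite connected discrete graph with vertex set $\mathcal V$ and edge set $\mathcal E$ (loops and parallel edges allowed), where each edge $e$ is assigned a length $L(e)\in(0,\infty)$ and identified with the interval $[0,L(e)]$, the endpoints $0$ and $L(e)$ corresponding to the originating vertex $o(e)$ and terminal vertex $t(e)$ of $e$; with the natural path metric $\mathrm{dist}$, $\Gamma$ is a compact metric space. A graph is equilateral if all its edges have the same length. A pumpkin graph consists of two vertices $v_1,v_2$ and a collection of edges each of which connects $v_1$ with $v_2$. A complete graph is a graph such that for each pair of distinct vertices there is exactly one edge connecting the two and every vertex has degree $V-1$, where $V$ is the number of vertices. The standard Laplacian $-\Delta_\Gamma$ in $L^2(\Gamma)=\bigoplus_{e}L^2(0,L(e))$ acts as $f\mapsto -f_e''$ on every edge ($f_e:=f|_e$), on the domain of functions $f$ with $f_e\in H^2(0,L(e))$ for all $e$, continuous on $\Gamma$, and satisfying the Kirchhoff condition $\sum_{t(e)=v} f_e'(L(e)) - \sum_{o(e)=v} f_e'(0)=0$ at each vertex $v$. Its eigenvalues, counted with multiplicities, are $0=\mu_1(\Gamma)<\mu_2(\Gamma)\le\mu_3(\Gamma)\le\dots$. Eigenfunctions are always taken real-valued. $M$ is the set of all $x\in\Gamma$ for which there exists an eigenfunction $\psi$ corresponding to $\mu_2(\Gamma)$ with $\psi(x)=\max_{y\in\Gamma}\psi(y)$. $M_{\mathrm{loc}}$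 is the set of all $x\in\Gamma$ for which there exist an eigenfunction $\psi$ corresponding to $\mu_2(\Gamma)$ and $\varepsilon>0$ with $0\ne\psi(x)=\max_{y\in B_\varepsilon(x)}\psi(y)$, where $B_\varepsilon(x)=\{y\in\Gamma:\mathrm{dist}(x,y)<\varepsilon\}$.
   Formalization: A pumpkin graph is required to have at least two edges; with a single edge Γ is an interval, the eigenfunctions for μ₂ are multiples of cos(πx/L), and M = M_loc consists only of the two endpoints, so the claim fails there. *)

theory Defs
  imports "HOL-Analysis.Analysis" "Graph_Theory.Digraph_Component"
begin

section \<open>Metric graphs\<close>

text \<open>
  The orientation of the underlying digraph only fixes the parametrisation of each edge \<open>e\<close> by
  \<open>[0, L e]\<close>: \<open>tail G e\<close> is the originating vertex $o(e)$ and \<open>head G e\<close> the terminal vertex $t(e)$.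
  Loops and parallel edges are allowed.
  \<open>Digraph_Component.connected\<close> is connectedness of the underlying undirected graph.
\<close>

locale metric_graph = fin_digraph G
  for G :: "('v, 'e) pre_digraph" +
  fixes L :: "'e \<Rightarrow> real"
  assumes connected_graph: "Digraph_Component.connected G"
    and length_pos: "e \<in> arcs G \<Longrightarrow> 0 < L e"

definition equilateral :: "('v, 'e) pre_digraph \<Rightarrow> ('e \<Rightarrow> real) \<Rightarrow> bool" where
  "equilateral G L \<longleftrightarrow> (\<forall>e\<in>arcs G. \<forall>e'\<in>arcs G. L e = L e')"

text \<open>
  A pumpkin graph is understood to have at least two edges. With a single edge it is an interval,
  where a second eigenfunction attains its maximum only at an end point.
\<close>

definition pumpkin_graph :: "('v, 'e) pre_digraph \<Rightarrow> bool" where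
  "pumpkin_graph G \<longleftrightarrow>
     (\<exists>v1 v2. v1 \<noteq> v2 \<and> verts G = {v1, v2} \<and>
        (\<forall>e\<in>arcs G. {tail G e, head G e} = {v1, v2})) \<and>
     2 \<le> card (arcs G)"

definition complete_graph :: "('v, 'e) pre_digraph \<Rightarrow> bool" where
  "complete_graph G \<longleftrightarrow>
     (\<forall>v\<in>verts G. \<forall>w\<in>verts G. v \<noteq> w \<longrightarrow> (\<exists>!e. e \<in> arcs G \<and> {tail G e, head G e} = {v, w})) \<and>
     (\<forall>v\<in>verts G. in_degree G v + out_degree G v = card (verts G) - 1)"

text \<open>
  The points of \<open>\<Gamma>\<close>, i.e. of the disjoint union of the intervals \<open>[0, L e]\<close> with end points glued
  at the vertices, are the vertices together with the points \<open>0 < x < L e\<close> inside the edges;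
  \<open>edge_point G L e\<close> is the map from \<open>[0, L e]\<close> to \<open>\<Gamma>\<close>.
\<close>

datatype ('v, 'e) graph_point = Vertex 'v | Inner 'e real

definition edge_point ::
    "('v, 'e) pre_digraph \<Rightarrow> ('e \<Rightarrow> real) \<Rightarrow> 'e \<Rightarrow> real \<Rightarrow> ('v, 'e) graph_point" where
  "edge_point G L e x =
     (if x = 0 then Vertex (tail G e) else if x = L e then Vertex (head G e) else Inner e x)"

definition graph_space ::
    "('v, 'e) pre_digraph \<Rightarrow> ('e \<Rightarrow> real) \<Rightarrow> ('v, 'e) graph_point set" where
  "graph_space G L = Vertex ` verts G \<union> {Inner e x | e x. e \<in> arcs G \<and> 0 < x \<and> x < L e}"

text \<open>
  \<open>path_of_length G L p q l\<close>: there is a path from \<open>p\<close> to \<open>q\<close> of length \<open>l\<close> that is a concatenation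
  of finitely many segments, each inside one edge.
\<close>

inductive path_of_length ::
    "('v, 'e) pre_digraph \<Rightarrow> ('e \<Rightarrow> real) \<Rightarrow> ('v, 'e) graph_point \<Rightarrow> ('v, 'e) graph_point \<Rightarrow> real \<Rightarrow> bool"
  for G L where
  trivial: "p \<in> graph_space G L \<Longrightarrow> path_of_length G L p p 0"
| segment: "path_of_length G L p (edge_point G L e s) l \<Longrightarrow> e \<in> arcs G \<Longrightarrow>
     s \<in> {0..L e} \<Longrightarrow> t \<in> {0..L e} \<Longrightarrow>
     path_of_length G L p (edge_point G L e t) (l + \<bar>t - s\<bar>)"

definition graph_dist ::
    "('v, 'e) pre_digraph \<Rightarrow> ('e \<Rightarrow> real) \<Rightarrow> ('v, 'e) graph_point \<Rightarrow> ('v, 'e) graph_point \<Rightarrow> real" where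
  "graph_dist G L p q = Inf {l. path_of_length G L p q l}"

definition graph_ball ::
    "('v, 'e) pre_digraph \<Rightarrow> ('e \<Rightarrow> real) \<Rightarrow> ('v, 'e) graph_point \<Rightarrow> real \<Rightarrow> ('v, 'e) graph_point set" where
  "graph_ball G L p \<epsilon> = {q \<in> graph_space G L. graph_dist G L p q < \<epsilon>}"

definition continuous_on_graph ::
    "('v, 'e) pre_digraph \<Rightarrow> ('e \<Rightarrow> real) \<Rightarrow> (('v, 'e) graph_point \<Rightarrow> real) \<Rightarrow> bool" where
  "continuous_on_graph G L f \<longleftrightarrow>
     (\<forall>p\<in>graph_space G L. \<forall>\<epsilon>>0. \<exists>\<delta>>0. \<forall>q\<in>graph_ball G L p \<delta>. \<bar>f q - f p\<bar> < \<epsilon>)"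

section \<open>Sobolev spaces on an interval\<close>

definition square_integrable :: "real \<Rightarrow> real \<Rightarrow> (real \<Rightarrow> real) \<Rightarrow> bool" where
  "square_integrable a b u \<longleftrightarrow>
     u \<in> borel_measurable (lebesgue_on {a<..<b}) \<and> integrable (lebesgue_on {a<..<b}) (\<lambda>x. (u x)\<^sup>2)"

text \<open>The space $C_c^\infty(a,b)$, with functions extended by zero to the real line.\<close>

definition test_function :: "real \<Rightarrow> real \<Rightarrow> (real \<Rightarrow> real) \<Rightarrow> bool" where
  "test_function a b \<phi> \<longleftrightarrow>
     (\<forall>n. (deriv ^^ n) \<phi> differentiable_on UNIV) \<and>
     (\<exists>c d. a < c \<and> d < b \<and> (\<forall>x. x \<notin> {c..d} \<longrightarrow> \<phi> x = 0))"

definition weak_derivative :: "real \<Rightarrow> real \<Rightarrow> (real \<Rightarrow> real) \<Rightarrow> (real \<Rightarrow> real) \<Rightarrow> bool" where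
  "weak_derivative a b u g \<longleftrightarrow>
     (\<forall>\<phi>. test_function a b \<phi> \<longrightarrow>
        (LINT x|lebesgue_on {a<..<b}. u x * deriv \<phi> x) = - (LINT x|lebesgue_on {a<..<b}. g x * \<phi> x))"

text \<open>\<open>H2_with a b u h\<close>: \<open>u\<close> is in $H^2(a,b)$ with second weak derivative \<open>h\<close>.\<close>

definition H2_with :: "real \<Rightarrow> real \<Rightarrow> (real \<Rightarrow> real) \<Rightarrow> (real \<Rightarrow> real) \<Rightarrow> bool" where
  "H2_with a b u h \<longleftrightarrow> square_integrable a b u \<and> square_integrable a b h \<and>
     (\<exists>g. square_integrable a b g \<and> weak_derivative a b u g \<and> weak_derivative a b g h)"

definition H2 :: "real \<Rightarrow> real \<Rightarrow> (real \<Rightarrow> real) \<Rightarrow> bool" where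
  "H2 a b u \<longleftrightarrow> (\<exists>h. H2_with a b u h)"

section \<open>The standard Laplacian\<close>

definition on_edge ::
    "('v, 'e) pre_digraph \<Rightarrow> ('e \<Rightarrow> real) \<Rightarrow> (('v, 'e) graph_point \<Rightarrow> real) \<Rightarrow> 'e \<Rightarrow> real \<Rightarrow> real" where
  "on_edge G L f e x = f (edge_point G L e x)"

text \<open>
  For \<open>f\<close> continuous on \<open>\<Gamma>\<close> with $f_e \in H^2$, \<open>on_edge G L f e\<close> is the $C^1$ representative on
  \<open>[0, L e]\<close>, so the boundary values of $f_e'$ are its one-sided derivatives.
\<close>

definition edge_derivative ::
    "('v, 'e) pre_digraph \<Rightarrow> ('e \<Rightarrow> real) \<Rightarrow> (('v, 'e) graph_point \<Rightarrow> real) \<Rightarrow> 'e \<Rightarrow> real \<Rightarrow> real" where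
  "edge_derivative G L f e x = vector_derivative (on_edge G L f e) (at x within {0..L e})"

definition kirchhoff_at ::
    "('v, 'e) pre_digraph \<Rightarrow> ('e \<Rightarrow> real) \<Rightarrow> (('v, 'e) graph_point \<Rightarrow> real) \<Rightarrow> 'v \<Rightarrow> bool" where
  "kirchhoff_at G L f v \<longleftrightarrow>
     (\<Sum>e\<in>in_arcs G v. edge_derivative G L f e (L e)) -
     (\<Sum>e\<in>out_arcs G v. edge_derivative G L f e 0) = 0"

definition laplacian_domain ::
    "('v, 'e) pre_digraph \<Rightarrow> ('e \<Rightarrow> real) \<Rightarrow> (('v, 'e) graph_point \<Rightarrow> real) set" where
  "laplacian_domain G L = {f.
     (\<forall>e\<in>arcs G. H2 0 (L e) (on_edge G L f e)) \<and>
     continuous_on_graph G L f \<and>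
     (\<forall>v\<in>verts G. kirchhoff_at G L f v)}"

text \<open>
  \<open>neg_laplacian G L f g\<close>: the operator maps \<open>f\<close> to \<open>g\<close>, i.e. $-f_e'' = g_e$ on every edge. Weak
  derivatives are determined up to null sets, so \<open>g\<close> is a representative of an element of
  $L^2(\Gamma)$.
\<close>

definition neg_laplacian ::
    "('v, 'e) pre_digraph \<Rightarrow> ('e \<Rightarrow> real) \<Rightarrow> (('v, 'e) graph_point \<Rightarrow> real) \<Rightarrow>
     (('v, 'e) graph_point \<Rightarrow> real) \<Rightarrow> bool" where
  "neg_laplacian G L f g \<longleftrightarrow> f \<in> laplacian_domain G L \<and>
     (\<forall>e\<in>arcs G. H2_with 0 (L e) (on_edge G L f e) (\<lambda>x. - on_edge G L g e x))"

definition eigenfunction ::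
    "('v, 'e) pre_digraph \<Rightarrow> ('e \<Rightarrow> real) \<Rightarrow> real \<Rightarrow> (('v, 'e) graph_point \<Rightarrow> real) \<Rightarrow> bool" where
  "eigenfunction G L \<mu> \<psi> \<longleftrightarrow>
     neg_laplacian G L \<psi> (\<lambda>p. \<mu> * \<psi> p) \<and> (\<exists>p\<in>graph_space G L. \<psi> p \<noteq> 0)"

definition independent_on_graph ::
    "('v, 'e) pre_digraph \<Rightarrow> ('e \<Rightarrow> real) \<Rightarrow> nat \<Rightarrow> (nat \<Rightarrow> ('v, 'e) graph_point \<Rightarrow> real) \<Rightarrow> bool" where
  "independent_on_graph G L k \<psi> \<longleftrightarrow>
     (\<forall>c. (\<forall>p\<in>graph_space G L. (\<Sum>i<k. c i * \<psi> i p) = 0) \<longrightarrow> (\<forall>i<k. c i = 0))"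

text \<open>
  The \<open>k\<close>-th eigenvalue ($k = 1, 2, \dots$) in the nondecreasing enumeration with multiplicities:
  the eigenvalues \<open>\<le> \<mu>\<close> make up at least \<open>k\<close> terms of it iff there are \<open>k\<close> linearly
  independent eigenfunctions with eigenvalues \<open>\<le> \<mu>\<close>.
\<close>

definition mu :: "('v, 'e) pre_digraph \<Rightarrow> ('e \<Rightarrow> real) \<Rightarrow> nat \<Rightarrow> real" where
  "mu G L k = Inf {\<mu>. \<exists>\<psi>. independent_on_graph G L k \<psi> \<and>
     (\<forall>i<k. \<exists>\<nu>\<le>\<mu>. eigenfunction G L \<nu> (\<psi> i))}"

definition M :: "('v, 'e) pre_digraph \<Rightarrow> ('e \<Rightarrow> real) \<Rightarrow> ('v, 'e) graph_point set" where
  "M G L = {p \<in> graph_space G L.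
     \<exists>\<psi>. eigenfunction G L (mu G L 2) \<psi> \<and> (\<forall>q\<in>graph_space G L. \<psi> q \<le> \<psi> p)}"

definition M_loc :: "('v, 'e) pre_digraph \<Rightarrow> ('e \<Rightarrow> real) \<Rightarrow> ('v, 'e) graph_point set" where
  "M_loc G L = {p \<in> graph_space G L.
     \<exists>\<psi> \<epsilon>. eigenfunction G L (mu G L 2) \<psi> \<and> \<epsilon> > 0 \<and> \<psi> p \<noteq> 0 \<and>
       (\<forall>q\<in>graph_ball G L p \<epsilon>. \<psi> q \<le> \<psi> p)}"

end

theory Submission
  imports Defs
begin

text \<open>
  Write \<open>\<kappa>\<^sup>2\<close> for $\mu_2$ and \<open>l\<close> for the edge length; then \<open>\<kappa> l = \<pi>\<close> for a pumpkin and
  \<open>cos (\<kappa> l) = - 1 / (V - 1)\<close> for a complete graph. Given a point at distance \<open>x\<^sub>0\<close> from the origin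
  of an edge, put \<open>cos (\<kappa> (x - x\<^sub>0))\<close> on that edge and extend it as symmetrically as the Kirchhoff
  conditions allow: the remaining edges of the pumpkin share the opposite sine part equally, and
  the remaining vertices of the complete graph share one value that makes all vertex values sum to
  zero. On every edge the result is a sinusoid of amplitude at most 1, so it is maximal at the given
  point.

  That nothing but constants lies below \<open>\<kappa>\<^sup>2\<close> is shown on classical solutions. For eigenvalues
  \<open>\<le> 0\<close> the energy identity forces all derivatives to vanish. For \<open>0 < k < \<kappa>\<close> we have
  \<open>sin (k l) \<noteq> 0\<close>, so an eigenfunction is determined by its vertex values, which satisfy
  \<open>deg v cos (k l) a\<^sub>v = \<Sum>\<^sub>w\<^sub>~\<^sub>v a\<^sub>w\<close> and hence vanish. Weak solutions are classical because a
  continuous function that is orthogonal to all second derivatives of test functions is affine;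
  the test functions for this are second antiderivatives of bumps.
\<close>

section \<open>Smooth functions and bumps\<close>

definition smooth :: "(real \<Rightarrow> real) \<Rightarrow> bool" where
  "smooth f \<longleftrightarrow> (\<forall>n. (deriv ^^ n) f differentiable_on UNIV)"

lemma smooth_has_derivative:
  assumes "smooth f"
  shows "(f has_real_derivative deriv f x) (at x)"
proof -
  have "(deriv ^^ 0) f differentiable_on UNIV"
    using assms unfolding smooth_def by blast
  then have "f differentiable (at x)"
    by (simp add: differentiable_on_def)
  then show ?thesis
    using DERIV_deriv_iff_real_differentiable by blast
qed

lemma smooth_deriv:
  assumes "smooth f"
  shows "smooth (deriv f)"
  unfolding smooth_def
proof
  fix n
  have "(deriv ^^ Suc n) f differentiable_on UNIV"
    using assms unfolding smooth_def by blast
  then show "(deriv ^^ n) (deriv f) differentiable_on UNIV"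
    by (simp add: funpow_swap1)
qed

lemma smooth_continuous_on: "smooth f \<Longrightarrow> continuous_on S f"
  by (meson DERIV_isCont continuous_at_imp_continuous_on smooth_has_derivative)

text \<open>All iterates of \<open>deriv\<close> stay inside a set closed under differentiation, so
  a smoothness proof only has to find such a set around the function; no formula for the n-th
  derivative is needed.\<close>

lemma smooth_coinduct:
  assumes "f \<in> S"
    and "\<And>g. g \<in> S \<Longrightarrow> \<exists>g'\<in>S. \<forall>x. (g has_real_derivative g' x) (at x)"
  shows "smooth f"
proof -
  have step: "g differentiable_on UNIV \<and> deriv g \<in> S" if g: "g \<in> S" for g
  proof -
    obtain g' where g': "g' \<in> S" "\<And>x. (g has_real_derivative g' x) (at x)"
      using assms(2)[OF g] by blast
    have "deriv g = g'"
      using g'(2) DERIV_imp_deriv by blast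
    moreover have "g differentiable_on UNIV"
      using g'(2) by (auto simp: differentiable_on_def real_differentiable_def)
    ultimately show ?thesis using g'(1) by simp
  qed
  have "(deriv ^^ n) f \<in> S" for n
    by (induction n) (use assms(1) step in auto)
  then show ?thesis
    unfolding smooth_def using step by blast
qed

lemma smooth_antiderivative:
  assumes "smooth f" and "\<And>x. (F has_real_derivative f x) (at x)"
  shows "smooth F"
proof (rule smooth_coinduct[where S = "insert F {g. smooth g}"])
  fix g assume g: "g \<in> insert F {g. smooth g}"
  show "\<exists>g'\<in>insert F {g. smooth g}. \<forall>x. (g has_real_derivative g' x) (at x)"
  proof (cases "g = F")
    case True
    then show ?thesis using assms by auto
  next
    case False
    then show ?thesis using g smooth_deriv smooth_has_derivative by blast
  qed
qed simp

lemma smooth_add: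
  assumes "smooth f" "smooth g"
  shows "smooth (\<lambda>x. f x + g x)"
proof (rule smooth_coinduct[where S = "{\<lambda>x. f x + g x | f g. smooth f \<and> smooth g}"])
  fix h assume "h \<in> {\<lambda>x. f x + g x | f g. smooth f \<and> smooth g}"
  then obtain f g where h: "h = (\<lambda>x. f x + g x)" and fg: "smooth f" "smooth g"
    by blast
  have "(h has_real_derivative deriv f x + deriv g x) (at x)" for x
    unfolding h by (intro DERIV_add smooth_has_derivative fg)
  then show "\<exists>h'\<in>{\<lambda>x. f x + g x | f g. smooth f \<and> smooth g}. \<forall>x. (h has_real_derivative h' x) (at x)"
    using smooth_deriv[OF fg(1)] smooth_deriv[OF fg(2)]
    by (intro bexI[where x = "\<lambda>x. deriv f x + deriv g x"]) auto
qed (use assms in blast)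

text \<open>Single products are not closed under differentiation: the Leibniz rule turns a product
  into a sum of two, so the coinduction set has to contain sums as well.\<close>

inductive_set sums_of_smooth_products :: "(real \<Rightarrow> real) set" where
  product: "smooth f \<Longrightarrow> smooth g \<Longrightarrow> (\<lambda>x. f x * g x) \<in> sums_of_smooth_products"
| sum: "f \<in> sums_of_smooth_products \<Longrightarrow> g \<in> sums_of_smooth_products \<Longrightarrow>
    (\<lambda>x. f x + g x) \<in> sums_of_smooth_products"

lemma smooth_mult:
  assumes "smooth f" "smooth g"
  shows "smooth (\<lambda>x. f x * g x)"
proof (rule smooth_coinduct[where S = sums_of_smooth_products])
  show "(\<lambda>x. f x * g x) \<in> sums_of_smooth_products"
    using assms by (rule sums_of_smooth_products.product)
next
  fix h assume "h \<in> sums_of_smooth_products"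
  then show "\<exists>h'\<in>sums_of_smooth_products. \<forall>x. (h has_real_derivative h' x) (at x)"
  proof induction
    case (product f g)
    have "((\<lambda>x. f x * g x) has_real_derivative deriv f x * g x + f x * deriv g x) (at x)" for x
      using DERIV_mult[OF smooth_has_derivative[OF product(1)] smooth_has_derivative[OF product(2)], of x]
      by (simp add: algebra_simps)
    moreover have "(\<lambda>x. deriv f x * g x + f x * deriv g x) \<in> sums_of_smooth_products"
      using product
      by (intro sums_of_smooth_products.sum sums_of_smooth_products.product smooth_deriv)
    ultimately show ?case
      by (intro bexI[where x = "\<lambda>x. deriv f x * g x + f x * deriv g x"] allI)
  next
    case (sum f g)
    then obtain f' g' where "f' \<in> sums_of_smooth_products" "g' \<in> sums_of_smooth_products"
      "\<And>x. (f has_real_derivative f' x) (at x)" "\<And>x. (g has_real_derivative g' x) (at x)"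
      by blast
    then show ?case
      by (intro bexI[where x = "\<lambda>x. f' x + g' x"] allI DERIV_add)
        (auto intro: sums_of_smooth_products.sum)
  qed
qed

lemma smooth_const: "smooth (\<lambda>x. c)"
proof (rule smooth_coinduct[where S = "range (\<lambda>c x. c)"])
  fix g :: "real \<Rightarrow> real" assume "g \<in> range (\<lambda>c x. c)"
  then have "(g has_real_derivative 0) (at x)" for x
    by auto
  then show "\<exists>g'\<in>range (\<lambda>c x. c). \<forall>x. (g has_real_derivative g' x) (at x)"
    by (intro bexI[where x = "\<lambda>x. 0"]) auto
qed simp

lemma smooth_compose_affine:
  assumes "smooth f"
  shows "smooth (\<lambda>x. f (a * x + b))"
\<comment> \<open>The factor \<open>c\<close> absorbs the powers of \<open>a\<close> that the chain
  rule produces.\<close>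
proof (rule smooth_coinduct[where S = "{\<lambda>x. c * f (a * x + b) | c f. smooth f}"])
  show "(\<lambda>x. f (a * x + b)) \<in> {\<lambda>x. c * f (a * x + b) | c f. smooth f}"
    using assms by (auto intro!: exI[of _ 1] exI[of _ f])
next
  fix h assume "h \<in> {\<lambda>x. c * f (a * x + b) | c f. smooth f}"
  then obtain c f where h: "h = (\<lambda>x. c * f (a * x + b))" and f: "smooth f"
    by blast
  have "(h has_real_derivative (c * a) * deriv f (a * x + b)) (at x)" for x
    unfolding h
    by (rule derivative_eq_intros DERIV_chain2[OF smooth_has_derivative[OF f]] refl | simp)+
  then show "\<exists>h'\<in>{\<lambda>x. c * f (a * x + b) | c f. smooth f}. \<forall>x. (h has_real_derivative h' x) (at x)"
    using smooth_deriv[OF f]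
    by (intro bexI[where x = "\<lambda>x. (c * a) * deriv f (a * x + b)"]) blast+
qed

section \<open>Flat exponentials, bumps and ramps\<close>

text \<open>All derivatives of \<open>exp (- (1 / x))\<close>, extended by zero, have this form; so
  the family, indexed by the polynomial, is closed under differentiation.\<close>

definition flat_poly :: "real poly \<Rightarrow> real \<Rightarrow> real" where
  "flat_poly p x = (if x > 0 then poly p (1 / x) * exp (- (1 / x)) else 0)"

lemma tendsto_poly_exp_minus: "((\<lambda>y. poly p y * exp (- y)) \<longlongrightarrow> (0::real)) at_top"
proof -
  have "((\<lambda>y. \<Sum>i\<le>degree p. coeff p i * (y ^ i / exp y)) \<longlongrightarrow> (\<Sum>i\<le>degree p. coeff p i * 0)) at_top"
    by (intro tendsto_sum tendsto_mult tendsto_const tendsto_power_div_exp_0)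
  moreover have "(\<Sum>i\<le>degree p. coeff p i * (y ^ i / exp y)) = poly p y * exp (- y)" for y
    by (simp add: poly_altdef sum_distrib_right exp_minus divide_inverse mult.assoc)
  ultimately show ?thesis by simp
qed

text \<open>With \<open>y = 1 / x\<close> one has \<open>d/dx = - y^2 d/dy\<close>, which turns
  \<open>p\<close> into \<open>y^2 (p - p')\<close>. At 0 the difference quotient from the right is
  \<open>y p(y) exp (- y)\<close>, which tends to 0 as \<open>y\<close> grows.\<close>

lemma flat_poly_has_derivative:
  "(flat_poly p has_real_derivative flat_poly ([:0, 0, 1:] * (p - pderiv p)) x) (at x)"
proof -
  consider "x > 0" | "x < 0" | "x = 0" by linarith
  then show ?thesis
  proof cases
    case 1
    have ev: "\<forall>\<^sub>F y in nhds x. flat_poly p y = poly p (1 / y) * exp (- (1 / y))"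
      using eventually_nhds_in_open[of "{0<..}" x] 1
      by (auto elim!: eventually_mono simp: flat_poly_def)
    have "((\<lambda>y. poly p (1 / y) * exp (- (1 / y))) has_real_derivative
        flat_poly ([:0, 0, 1:] * (p - pderiv p)) x) (at x)"
      using 1
      by (auto intro!: derivative_eq_intros DERIV_chain2[OF poly_DERIV]
          simp: flat_poly_def field_simps power2_eq_square)
    then show ?thesis
      using DERIV_cong_ev[OF refl ev refl] by simp
  next
    case 2
    have ev: "\<forall>\<^sub>F y in nhds x. flat_poly p y = 0"
      using eventually_nhds_in_open[of "{..<0}" x] 2
      by (auto elim!: eventually_mono simp: flat_poly_def)
    show ?thesis
      using DERIV_cong_ev[OF refl ev, of 0 0] 2
      by (simp add: flat_poly_def[of _ x])
  next
    case 3
    have "((\<lambda>h. flat_poly p h / h) \<longlongrightarrow> 0) (at 0)"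
    proof (rule filterlim_split_at)
      show "((\<lambda>h. flat_poly p h / h) \<longlongrightarrow> 0) (at_left 0)"
        by (rule tendsto_eventually) (auto simp: eventually_at_filter flat_poly_def)
      have "((\<lambda>h. poly ([:0, 1:] * p) (inverse h) * exp (- inverse h)) \<longlongrightarrow> 0) (at_right 0)"
        by (rule filterlim_compose[OF tendsto_poly_exp_minus filterlim_inverse_at_top_right])
      moreover have "\<forall>\<^sub>F h in at_right 0. poly ([:0, 1:] * p) (inverse h) * exp (- inverse h) = flat_poly p h / h"
        by (auto simp: eventually_at_filter flat_poly_def field_simps)
      ultimately show "((\<lambda>h. flat_poly p h / h) \<longlongrightarrow> 0) (at_right 0)"
        by (rule Lim_transform_eventually)
    qed
    then show ?thesis
      using 3 by (simp add: DERIV_def flat_poly_def)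
  qed
qed

lemma smooth_flat_poly: "smooth (flat_poly p)"
  by (rule smooth_coinduct[where S = "range flat_poly"]) (use flat_poly_has_derivative in blast)+

lemma bump_exists:
  assumes "\<delta> > 0"
  obtains \<eta> where "smooth \<eta>" "\<And>x. \<eta> x \<ge> 0" "\<And>x. \<bar>x\<bar> < \<delta> \<Longrightarrow> \<eta> x > 0" "\<And>x. \<bar>x\<bar> \<ge> \<delta> \<Longrightarrow> \<eta> x = 0"
proof
  let ?f = "flat_poly 1"
  \<comment> \<open>The product is positive exactly where both \<open>x + \<delta>\<close> and
    \<open>\<delta> - x\<close> are positive.\<close>
  let ?\<eta> = "\<lambda>x. ?f (1 * x + \<delta>) * ?f ((-1) * x + \<delta>)"
  show "smooth ?\<eta>"
    by (intro smooth_mult smooth_compose_affine smooth_flat_poly)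
  show "?\<eta> x \<ge> 0" "\<bar>x\<bar> < \<delta> \<Longrightarrow> ?\<eta> x > 0" "\<bar>x\<bar> \<ge> \<delta> \<Longrightarrow> ?\<eta> x = 0" for x
    by (auto simp: flat_poly_def)
qed

lemma continuous_antiderivative:
  fixes f :: "real \<Rightarrow> real"
  assumes "continuous_on UNIV f"
  obtains F where "\<And>x. (F has_real_derivative f x) (at x)" "F a = 0"
proof -
  have "\<exists>F. \<forall>x::real. -\<infinity> < ereal x \<longrightarrow> ereal x < \<infinity> \<longrightarrow> (F has_vector_derivative f x) (at x)"
    by (rule einterval_antiderivative)
      (use assms in \<open>auto simp: continuous_on_eq_continuous_within\<close>)
  then obtain F where F: "\<And>x. (F has_real_derivative f x) (at x)"
    by (auto simp: has_real_derivative_iff_has_vector_derivative)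
  have "((\<lambda>x. F x - F a) has_real_derivative f x) (at x)" for x
    by (rule derivative_eq_intros F | simp)+
  then show ?thesis
    using that[of "\<lambda>x. F x - F a"] by simp
qed

lemma constant_on_convex_if_DERIV_0:
  fixes F :: "real \<Rightarrow> real"
  assumes "\<And>x. x \<in> S \<Longrightarrow> (F has_real_derivative 0) (at x)" "convex S" "x \<in> S" "y \<in> S"
  shows "F x = F y"
proof -
  obtain c where "\<And>z. z \<in> S \<Longrightarrow> F z = c"
    using has_field_derivative_zero_constant[of S F] assms(1,2) has_field_derivative_at_within
    by blast
  then show ?thesis
    using assms(3,4) by simp
qed

text \<open>\<open>H\<close> is a second antiderivative of a bump, normalised to vanish on the left.
  On the right it is affine, so combinations of translates whose affine ends cancel have compact
  support and can be used as test functions.\<close>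

lemma ramp_exists:
  assumes "\<delta> > 0"
  obtains \<eta> H p q where
    "smooth H" "deriv (deriv H) = \<eta>"
    "\<And>x. \<eta> x \<ge> 0" "\<And>x. \<bar>x\<bar> < \<delta> \<Longrightarrow> \<eta> x > 0" "\<And>x. \<bar>x\<bar> \<ge> \<delta> \<Longrightarrow> \<eta> x = 0"
    "\<And>x. x \<le> -\<delta> \<Longrightarrow> H x = 0" "\<And>x. x \<ge> \<delta> \<Longrightarrow> H x = p * x + q"
proof -
  obtain \<eta> where eta: "smooth \<eta>" "\<And>x. \<eta> x \<ge> 0" "\<And>x. \<bar>x\<bar> < \<delta> \<Longrightarrow> \<eta> x > 0"
      "\<And>x. \<bar>x\<bar> \<ge> \<delta> \<Longrightarrow> \<eta> x = 0"
    using bump_exists[OF assms] by blast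
  obtain F where F: "\<And>x. (F has_real_derivative \<eta> x) (at x)" "F (-\<delta>) = 0"
    using continuous_antiderivative smooth_continuous_on[OF eta(1)] by blast
  have smF: "smooth F"
    using smooth_antiderivative[OF eta(1) F(1)] .
  obtain H where H: "\<And>x. (H has_real_derivative F x) (at x)" "H (-\<delta>) = 0"
    using continuous_antiderivative smooth_continuous_on[OF smF] by blast
  have smH: "smooth H"
    using smooth_antiderivative[OF smF H(1)] .
  have F_left: "F x = 0" if "x \<le> -\<delta>" for x
  proof -
    have "F x = F (-\<delta>)"
    proof (rule constant_on_convex_if_DERIV_0[of "{..-\<delta>}" F])
      show "(F has_real_derivative 0) (at y)" if "y \<in> {..-\<delta>}" for y
        using F(1)[of y] eta(4)[of y] that assms by simp
    qed (use that in auto)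
    then show ?thesis using F(2) by simp
  qed
  have F_right: "F x = F \<delta>" if "x \<ge> \<delta>" for x
  proof (rule constant_on_convex_if_DERIV_0[of "{\<delta>..}" F])
    show "(F has_real_derivative 0) (at y)" if "y \<in> {\<delta>..}" for y
      using F(1)[of y] eta(4)[of y] that by simp
  qed (use that in auto)
  have H_left: "H x = 0" if "x \<le> -\<delta>" for x
  proof -
    have "H x = H (-\<delta>)"
    proof (rule constant_on_convex_if_DERIV_0[of "{..-\<delta>}" H])
      show "(H has_real_derivative 0) (at y)" if "y \<in> {..-\<delta>}" for y
        using H(1)[of y] F_left[of y] that by simp
    qed (use that in auto)
    then show ?thesis using H(2) by simp
  qed
  have H_right: "H x = F \<delta> * x + (H \<delta> - F \<delta> * \<delta>)" if "x \<ge> \<delta>" for x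
  proof -
    have "H x - F \<delta> * x = H \<delta> - F \<delta> * \<delta>"
    proof (rule constant_on_convex_if_DERIV_0[of "{\<delta>..}" "\<lambda>x. H x - F \<delta> * x"])
      show "((\<lambda>x. H x - F \<delta> * x) has_real_derivative 0) (at y)" if "y \<in> {\<delta>..}" for y
        by (rule derivative_eq_intros H refl)+ (use F_right[of y] that in simp)
    qed (use that in auto)
    then show ?thesis by simp
  qed
  have "deriv H = F" "deriv F = \<eta>"
    using H F DERIV_imp_deriv by blast+
  then have "deriv (deriv H) = \<eta>" by simp
  from that[of H \<eta>, OF smH this eta(2-4) H_left H_right] show ?thesis .
qed

section \<open>Weak and classical derivatives\<close>

lemma test_function_smooth: "test_function a b \<phi> \<Longrightarrow> smooth \<phi>"
  by (simp add: test_function_def smooth_def)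

lemma test_function_deriv:
  assumes "test_function a b \<phi>"
  shows "test_function a b (deriv \<phi>)"
proof -
  obtain c d where cd: "a < c" "d < b" "\<And>x. x \<notin> {c..d} \<Longrightarrow> \<phi> x = 0"
    using assms unfolding test_function_def by blast
  have "deriv \<phi> x = 0" if x: "x \<notin> {c..d}" for x
  proof -
    have "\<forall>\<^sub>F y in nhds x. \<phi> y = 0"
      by (rule eventually_mono[OF eventually_nhds_in_open[of "- {c..d}" x]]) (use x cd(3) in auto)
    from DERIV_cong_ev[OF refl this refl] have "(\<phi> has_real_derivative 0) (at x)"
      by simp
    then show ?thesis by (rule DERIV_imp_deriv)
  qed
  then show ?thesis
    using cd(1,2) smooth_deriv[OF test_function_smooth[OF assms]]
    unfolding test_function_def smooth_def by blast
qed

lemma test_function_boundary: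
  assumes "test_function a b \<phi>"
  shows "\<phi> a = 0" "\<phi> b = 0"
proof -
  obtain c d where "a < c" "d < b" "\<And>x. x \<notin> {c..d} \<Longrightarrow> \<phi> x = 0"
    using assms unfolding test_function_def by blast
  then show "\<phi> a = 0" "\<phi> b = 0" by auto
qed

lemma integrable_lebesgue_on_open_interval:
  fixes f :: "real \<Rightarrow> real"
  assumes "continuous_on {a..b} f"
  shows "integrable (lebesgue_on {a<..<b}) f"
proof -
  have "set_integrable lebesgue {a..b} f"
    using continuous_imp_integrable_real[OF assms]
    by (simp add: set_integrable_def integrable_restrict_space)
  then have "set_integrable lebesgue {a<..<b} f"
    by (rule set_integrable_subset) auto
  then show ?thesis
    by (simp add: set_integrable_def integrable_restrict_space)
qed

text \<open>Bridge from the Lebesgue integrals over open intervals in the Sobolev definitions to the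
  gauge integrals over closed intervals, for which the fundamental theorem of calculus is
  used.\<close>

lemma LINT_lebesgue_on_open_interval:
  fixes f :: "real \<Rightarrow> real"
  assumes "continuous_on {a..b} f"
  shows "(LINT x|lebesgue_on {a<..<b}. f x) = integral {a..b} f"
proof -
  have "(LINT x|lebesgue_on {a<..<b}. f x) = integral {a<..<b} f"
    using integrable_lebesgue_on_open_interval[OF assms] by (rule lebesgue_integral_eq_integral) auto
  then show ?thesis
    by (simp add: integral_open_interval_real)
qed

text \<open>Fundamental theorem for the product of \<open>u\<close> and \<open>\<phi>\<close>; the
  boundary terms vanish because \<open>\<phi>\<close> is zero at both ends.\<close>

lemma integral_by_parts_test_function:
  assumes \<phi>: "test_function a b \<phi>" and "a \<le> b"
    and u: "\<And>x. x \<in> {a..b} \<Longrightarrow> (u has_real_derivative u' x) (at x within {a..b})"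
    and u': "continuous_on {a..b} u'"
  shows "integral {a..b} (\<lambda>x. u x * deriv \<phi> x) = - integral {a..b} (\<lambda>x. u' x * \<phi> x)"
proof -
  have smooth: "smooth \<phi>" "smooth (deriv \<phi>)"
    using test_function_smooth \<phi> smooth_deriv by blast+
  have contu: "continuous_on {a..b} u"
    using u DERIV_continuous_on by blast
  have "((\<lambda>x. u x * deriv \<phi> x + u' x * \<phi> x) has_integral u b * \<phi> b - u a * \<phi> a) {a..b}"
  proof (rule fundamental_theorem_of_calculus[OF \<open>a \<le> b\<close>])
    fix x assume x: "x \<in> {a..b}"
    have "((\<lambda>x. u x * \<phi> x) has_real_derivative u x * deriv \<phi> x + u' x * \<phi> x) (at x within {a..b})"
      using DERIV_mult'[OF u[OF x] has_field_derivative_at_within[OF smooth_has_derivative[OF smooth(1)]]]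
      by simp
    then show "((\<lambda>x. u x * \<phi> x) has_vector_derivative u x * deriv \<phi> x + u' x * \<phi> x) (at x within {a..b})"
      by (simp add: has_real_derivative_iff_has_vector_derivative)
  qed
  then have "integral {a..b} (\<lambda>x. u x * deriv \<phi> x + u' x * \<phi> x) = 0"
    using test_function_boundary[OF \<phi>] by (simp add: integral_unique)
  moreover have "integral {a..b} (\<lambda>x. u x * deriv \<phi> x + u' x * \<phi> x) =
      integral {a..b} (\<lambda>x. u x * deriv \<phi> x) + integral {a..b} (\<lambda>x. u' x * \<phi> x)"
    by (rule Henstock_Kurzweil_Integration.integral_add)
      (intro integrable_continuous_real continuous_on_mult contu u' smooth_continuous_on smooth)+
  ultimately show ?thesis by simp
qed

lemma weak_derivative_if_classical:
  assumes "a \<le> b"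
    and u: "\<And>x. x \<in> {a..b} \<Longrightarrow> (u has_real_derivative u' x) (at x within {a..b})"
    and u': "continuous_on {a..b} u'"
  shows "weak_derivative a b u u'"
  unfolding weak_derivative_def
proof (intro allI impI)
  fix \<phi> assume \<phi>: "test_function a b \<phi>"
  have smooth: "smooth \<phi>" "smooth (deriv \<phi>)"
    using test_function_smooth \<phi> smooth_deriv by blast+
  have contu: "continuous_on {a..b} u"
    using u DERIV_continuous_on by blast
  have "continuous_on {a..b} (\<lambda>x. u x * deriv \<phi> x)" "continuous_on {a..b} (\<lambda>x. u' x * \<phi> x)"
    by (intro continuous_on_mult contu u' smooth_continuous_on smooth)+
  then show "(LINT x|lebesgue_on {a<..<b}. u x * deriv \<phi> x) = - (LINT x|lebesgue_on {a<..<b}. u' x * \<phi> x)"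
    using integral_by_parts_test_function[OF \<phi> assms] by (simp add: LINT_lebesgue_on_open_interval)
qed

lemma square_integrable_if_continuous:
  assumes "continuous_on {a..b} u"
  shows "square_integrable a b u"
  unfolding square_integrable_def
  using integrable_lebesgue_on_open_interval[OF assms]
    integrable_lebesgue_on_open_interval[of a b "\<lambda>x. (u x)\<^sup>2"] assms
  by (auto intro: continuous_intros)

lemma H2_with_if_classical:
  assumes "a \<le> b"
    and u: "\<And>x. x \<in> {a..b} \<Longrightarrow> (u has_real_derivative u' x) (at x within {a..b})"
    and u': "\<And>x. x \<in> {a..b} \<Longrightarrow> (u' has_real_derivative u'' x) (at x within {a..b})"
    and u'': "continuous_on {a..b} u''"
  shows "H2_with a b u u''"
proof -
  have "continuous_on {a..b} u" "continuous_on {a..b} u'"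
    using u u' DERIV_continuous_on by blast+
  then show ?thesis
    unfolding H2_with_def
    using u'' weak_derivative_if_classical[OF \<open>a \<le> b\<close> u] weak_derivative_if_classical[OF \<open>a \<le> b\<close> u']
    by (blast intro: square_integrable_if_continuous)
qed

section \<open>Weak solutions are classical\<close>

text \<open>Substituting \<open>t = s + y\<close> moves the translation from the bump to
  \<open>w\<close>. Outside the window of radius \<open>\<delta>\<close> around \<open>y\<close> the
  integrand is zero, so the interval may be enlarged to \<open>{l..r}\<close>.\<close>

lemma integral_mult_translated_bump:
  fixes w \<eta> :: "real \<Rightarrow> real"
  assumes "continuous_on UNIV w" "continuous_on UNIV \<eta>"
    and "\<And>x. \<bar>x\<bar> \<ge> \<delta> \<Longrightarrow> \<eta> x = 0" and "l \<le> y - \<delta>" "y + \<delta> \<le> r"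
  shows "((\<lambda>t. w t * \<eta> (t - y)) has_integral integral {-\<delta>..\<delta>} (\<lambda>s. w (s + y) * \<eta> s)) {l..r}"
proof (rule has_integral_on_superset)
  show "((\<lambda>t. w t * \<eta> (t - y)) has_integral integral {-\<delta>..\<delta>} (\<lambda>s. w (s + y) * \<eta> s)) {-\<delta> + y..\<delta> + y}"
  proof -
    have "integral {-\<delta>..\<delta>} (\<lambda>s. w (s + y) * \<eta> s) = integral {-\<delta> + y..\<delta> + y} (\<lambda>t. w t * \<eta> (t - y))"
      using integral_shift_Icc_real[of "-\<delta>" \<delta> "\<lambda>t. w t * \<eta> (t - y)" y]
      by (simp add: o_def add.commute)
    moreover have "continuous_on {-\<delta> + y..\<delta> + y} (\<lambda>t. w t * \<eta> (t - y))"
      by (intro continuous_on_mult continuous_on_compose2[OF assms(2)] continuous_intros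
          continuous_on_subset[OF assms(1)]) auto
    ultimately show ?thesis
      by (metis integrable_continuous_real integrable_integral)
  qed
  show "w t * \<eta> (t - y) = 0" if "t \<notin> {-\<delta> + y..\<delta> + y}" for t
  proof -
    have "\<bar>t - y\<bar> \<ge> \<delta>" using that by (auto simp: abs_if)
    then show ?thesis using assms(3) by simp
  qed
  show "{-\<delta> + y..\<delta> + y} \<subseteq> {l..r}"
    using assms(4,5) by auto
qed

text \<open>The left side is a multiple of the second divided difference of \<open>w\<close>: its
  vanishing means that three points of the graph are collinear. A nonzero value is refuted by a test
  function whose second derivative is the same weighted combination of bumps at \<open>a\<close>,
  \<open>b\<close> and \<open>c\<close>.\<close>

lemma affine_if_orthogonal_to_second_derivatives:
  fixes w :: "real \<Rightarrow> real"
  assumes w: "continuous_on UNIV w"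
    and orth: "\<And>\<phi>. test_function l r \<phi> \<Longrightarrow> integral {l..r} (\<lambda>x. w x * deriv (deriv \<phi>) x) = 0"
    and abc: "l < a" "a < b" "b < c" "c < r"
  shows "(c - b) * w a + (a - c) * w b + (b - a) * w c = 0"
proof (rule ccontr)
  \<comment> \<open>The claimed expression for \<open>w\<close> translated by \<open>s\<close>; its
    value at 0 is the one assumed to be nonzero.\<close>
  define \<Theta> where "\<Theta> s = (c - b) * w (s + a) + (a - c) * w (s + b) + (b - a) * w (s + c)" for s
  assume "\<not> ?thesis"
  then have D: "\<Theta> 0 \<noteq> 0" by (simp add: \<Theta>_def)
  have cont: "continuous_on UNIV (\<lambda>s. w (s + y))" for y
    by (intro continuous_on_compose2[OF w] continuous_intros) auto
  have cont\<Theta>: "continuous_on UNIV \<Theta>"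
    unfolding \<Theta>_def by (intro continuous_intros cont)
  then have "\<forall>e>0. \<exists>d>0. \<forall>s. dist s 0 < d \<longrightarrow> dist (\<Theta> s) (\<Theta> 0) < e"
    unfolding continuous_on_iff by blast
  then obtain d where d: "d > 0" "\<And>s. \<bar>s\<bar> < d \<Longrightarrow> \<bar>\<Theta> s - \<Theta> 0\<bar> < \<bar>\<Theta> 0\<bar>"
    using D zero_less_abs_iff[of "\<Theta> 0"] unfolding dist_real_def diff_zero by blast
  \<comment> \<open>With this radius \<open>\<Theta>\<close> keeps the sign of
    \<open>\<Theta> 0\<close> on the support of the bump, and the support of \<open>K H\<close> lies
    strictly inside \<open>{l..r}\<close>.\<close>
  define \<delta> where "\<delta> = min d (min (a - l) (r - c)) / 2"
  have \<delta>: "\<delta> > 0" "\<delta> < d" "\<delta> < a - l" "\<delta> < r - c"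
    using d(1) abc by (auto simp: \<delta>_def)
  obtain \<eta> H p q where H: "smooth H" "deriv (deriv H) = \<eta>"
      "\<And>x. x \<le> -\<delta> \<Longrightarrow> H x = 0" "\<And>x. x \<ge> \<delta> \<Longrightarrow> H x = p * x + q"
    and \<eta>: "\<And>x. \<eta> x \<ge> 0" "\<And>x. \<bar>x\<bar> < \<delta> \<Longrightarrow> \<eta> x > 0" "\<And>x. \<bar>x\<bar> \<ge> \<delta> \<Longrightarrow> \<eta> x = 0"
    using ramp_exists[OF \<delta>(1)] by metis
  have cont\<eta>: "continuous_on UNIV \<eta>"
    using H(1,2) smooth_continuous_on smooth_deriv by blast
  \<comment> \<open>The weights make the affine right ends of the three translates cancel.\<close>
  define K where "K F t = (c - b) * F (t - a) + (a - c) * F (t - b) + (b - a) * F (t - c)"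
    for F :: "real \<Rightarrow> real" and t
  have K_deriv: "deriv (K F) = K (deriv F)" if F: "smooth F" for F
  proof
    fix t
    have "(K F has_real_derivative K (deriv F) t) (at t)"
      unfolding K_def
      by (rule derivative_eq_intros DERIV_chain2[OF smooth_has_derivative[OF F]] refl | simp)+
    then show "deriv (K F) t = K (deriv F) t"
      by (rule DERIV_imp_deriv)
  qed
  have K_smooth: "smooth (K F)" if "smooth F" for F
  proof -
    have "smooth (\<lambda>t. F (1 * t + (- y)))" for y
      using that by (rule smooth_compose_affine)
    then show ?thesis
      unfolding K_def by (intro smooth_add smooth_mult smooth_const) simp_all
  qed
  have "K H t = 0" if "t \<notin> {a - \<delta>..c + \<delta>}" for t
  proof (cases "t < a - \<delta>")
    case True
    then show ?thesis using abc H(3) by (simp add: K_def)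
  next
    case False
    then have t: "t > c + \<delta>" using that by auto
    have "K H t = (c - b) * (p * (t - a) + q) + (a - c) * (p * (t - b) + q) + (b - a) * (p * (t - c) + q)"
      unfolding K_def using t abc by (simp add: H(4))
    also have "\<dots> = 0" by algebra
    finally show ?thesis .
  qed
  then have "test_function l r (K H)"
    using K_smooth[OF H(1)] \<delta> unfolding test_function_def smooth_def
    by (intro conjI exI[of _ "a - \<delta>"] exI[of _ "c + \<delta>"]) auto
  then have zero: "integral {l..r} (\<lambda>x. w x * K \<eta> x) = 0"
    using orth[of "K H"] K_deriv[OF H(1)] K_deriv[OF smooth_deriv[OF H(1)]] H(2) by simp
  let ?J = "\<lambda>y. integral {-\<delta>..\<delta>} (\<lambda>s. w (s + y) * \<eta> s)"
  have J: "((\<lambda>t. w t * \<eta> (t - y)) has_integral ?J y) {l..r}" if "a \<le> y" "y \<le> c" for y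
    by (rule integral_mult_translated_bump[OF w cont\<eta> \<eta>(3)]) (use that \<delta> in auto)
  have "((\<lambda>t. (c - b) * (w t * \<eta> (t - a)) + (a - c) * (w t * \<eta> (t - b)) + (b - a) * (w t * \<eta> (t - c)))
      has_integral (c - b) * ?J a + (a - c) * ?J b + (b - a) * ?J c) {l..r}"
    by (intro has_integral_add has_integral_mult_right J) (use abc in auto)
  moreover have "(\<lambda>t. (c - b) * (w t * \<eta> (t - a)) + (a - c) * (w t * \<eta> (t - b)) + (b - a) * (w t * \<eta> (t - c)))
      = (\<lambda>t. w t * K \<eta> t)"
    by (auto simp: K_def algebra_simps)
  ultimately have "((\<lambda>t. w t * K \<eta> t) has_integral (c - b) * ?J a + (a - c) * ?J b + (b - a) * ?J c) {l..r}"
    by simp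
  from integral_unique[OF this] zero have sumJ: "(c - b) * ?J a + (a - c) * ?J b + (b - a) * ?J c = 0"
    by simp
  have int: "((\<lambda>s. w (s + y) * \<eta> s) has_integral ?J y) {-\<delta>..\<delta>}" for y
    by (intro integrable_integral integrable_continuous_real continuous_on_mult
        continuous_on_subset[OF cont] continuous_on_subset[OF cont\<eta>]) auto
  \<comment> \<open>The same combination of integrals with the translations moved to
    \<open>w\<close>: it is the integral of \<open>\<Theta> s * \<eta> s\<close>.\<close>
  have "((\<lambda>s. (c - b) * (w (s + a) * \<eta> s) + (a - c) * (w (s + b) * \<eta> s) + (b - a) * (w (s + c) * \<eta> s))
      has_integral (c - b) * ?J a + (a - c) * ?J b + (b - a) * ?J c) {-\<delta>..\<delta>}"
    by (intro has_integral_add has_integral_mult_right int)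
  moreover have "(\<lambda>s. (c - b) * (w (s + a) * \<eta> s) + (a - c) * (w (s + b) * \<eta> s) + (b - a) * (w (s + c) * \<eta> s))
      = (\<lambda>s. \<Theta> s * \<eta> s)"
    by (auto simp: \<Theta>_def algebra_simps)
  ultimately have "((\<lambda>s. \<Theta> s * \<eta> s) has_integral 0) {-\<delta>..\<delta>}"
    using sumJ by simp
  \<comment> \<open>The factor \<open>\<Theta> 0\<close> makes the integrand nonnegative on the
    support. Being continuous with integral zero it would have to vanish, which fails at 0.\<close>
  from integral_unique[OF has_integral_mult_right[OF this, of "\<Theta> 0"]]
  have integral_0: "integral {-\<delta>..\<delta>} (\<lambda>s. \<Theta> 0 * (\<Theta> s * \<eta> s)) = 0"
    by (simp only: mult_zero_right)
  have cont_product: "continuous_on {-\<delta>..\<delta>} (\<lambda>s. \<Theta> 0 * (\<Theta> s * \<eta> s))"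
    by (intro continuous_intros continuous_on_subset[OF cont\<Theta>] continuous_on_subset[OF cont\<eta>]) auto
  have nonneg: "\<Theta> 0 * (\<Theta> s * \<eta> s) \<ge> 0" if "s \<in> {-\<delta>..\<delta>}" for s
  proof -
    have "\<bar>\<Theta> s - \<Theta> 0\<bar> < \<bar>\<Theta> 0\<bar>" using that \<delta> d(2)[of s] by auto
    then have "\<Theta> 0 * \<Theta> s \<ge> 0"
      by (auto simp: zero_le_mult_iff abs_if split: if_splits)
    then show ?thesis using \<eta>(1)[of s] by (metis mult.assoc mult_nonneg_nonneg)
  qed
  have "- \<delta> < \<delta>" using \<delta>(1) by simp
  from iffD1[OF integral_eq_0_iff[OF cont_product this nonneg] integral_0]
  have "\<Theta> 0 * (\<Theta> 0 * \<eta> 0) = 0"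
    using \<delta>(1) by auto
  then show False
    using D \<eta>(2)[of 0] \<delta>(1) by simp
qed

text \<open>If \<open>V'' = u\<close>, then \<open>u + \<nu> V\<close> has weak second derivative
  zero and hence is affine. So \<open>u\<close> is an affine function minus \<open>\<nu> V\<close>,
  which is twice differentiable.\<close>

lemma classical_if_weak_eigenfunction:
  fixes u :: "real \<Rightarrow> real"
  assumes l: "0 < l" and contu: "continuous_on {0..l} u"
    and weak: "H2_with 0 l u (\<lambda>x. - (\<nu> * u x))"
  obtains u' where
    "\<And>x. x \<in> {0..l} \<Longrightarrow> (u has_real_derivative u' x) (at x within {0..l})"
    "\<And>x. x \<in> {0..l} \<Longrightarrow> (u' has_real_derivative - (\<nu> * u x)) (at x within {0..l})"
proof -
  \<comment> \<open>Constant continuation beyond both ends, so that antiderivatives exist on the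
    whole line.\<close>
  define v where "v x = u (max 0 (min l x))" for x
  have v_eq: "v x = u x" if "x \<in> {0..l}" for x
    using that by (simp add: v_def)
  have contv: "continuous_on UNIV v"
    unfolding v_def using l by (intro continuous_on_compose2[OF contu] continuous_intros) auto
  obtain V1 where V1: "\<And>x. (V1 has_real_derivative v x) (at x)"
    using continuous_antiderivative[OF contv] by blast
  have contV1: "continuous_on S V1" for S
    using V1 DERIV_isCont continuous_at_imp_continuous_on by blast
  obtain V where V: "\<And>x. (V has_real_derivative V1 x) (at x)"
    using continuous_antiderivative[OF contV1] by blast
  have contV: "continuous_on S V" for S
    using V DERIV_isCont continuous_at_imp_continuous_on by blast
  define w where "w x = v x + \<nu> * V x" for x
  have contw: "continuous_on UNIV w"
    unfolding w_def by (intro continuous_intros contv contV)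
  have orth: "integral {0..l} (\<lambda>x. w x * deriv (deriv \<phi>) x) = 0" if \<phi>: "test_function 0 l \<phi>" for \<phi>
  proof -
    have smooth: "smooth \<phi>" "smooth (deriv \<phi>)" "smooth (deriv (deriv \<phi>))"
      using test_function_smooth \<phi> smooth_deriv by blast+
    obtain g where g: "weak_derivative 0 l u g" "weak_derivative 0 l g (\<lambda>x. - (\<nu> * u x))"
      using weak unfolding H2_with_def by blast
    \<comment> \<open>Two applications of the weak derivative: \<open>deriv \<phi>\<close> is the
      test function for \<open>u\<close>, and \<open>\<phi>\<close> the one for
      \<open>g\<close>.\<close>
    have "(LINT x|lebesgue_on {0<..<l}. u x * deriv (deriv \<phi>) x) = (LINT x|lebesgue_on {0<..<l}. - (\<nu> * u x) * \<phi> x)"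
      using g \<phi> test_function_deriv[OF \<phi>] unfolding weak_derivative_def by simp
    moreover have "continuous_on {0..l} (\<lambda>x. u x * deriv (deriv \<phi>) x)"
      "continuous_on {0..l} (\<lambda>x. - (\<nu> * u x) * \<phi> x)"
      by (intro continuous_intros contu smooth_continuous_on smooth)+
    ultimately have "integral {0..l} (\<lambda>x. u x * deriv (deriv \<phi>) x) = integral {0..l} (\<lambda>x. - (\<nu> * u x) * \<phi> x)"
      by (simp only: LINT_lebesgue_on_open_interval)
    also have "integral {0..l} (\<lambda>x. u x * deriv (deriv \<phi>) x) = integral {0..l} (\<lambda>x. v x * deriv (deriv \<phi>) x)"
      by (rule integral_cong) (simp add: v_eq)
    also have "integral {0..l} (\<lambda>x. - (\<nu> * u x) * \<phi> x) = integral {0..l} (\<lambda>x. - \<nu> * (v x * \<phi> x))"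
      by (rule integral_cong) (simp add: v_eq)
    finally have 1: "integral {0..l} (\<lambda>x. v x * deriv (deriv \<phi>) x) = - \<nu> * integral {0..l} (\<lambda>x. v x * \<phi> x)"
      by simp
    have "integral {0..l} (\<lambda>x. V x * deriv (deriv \<phi>) x) = - integral {0..l} (\<lambda>x. V1 x * deriv \<phi> x)"
      by (rule integral_by_parts_test_function[OF test_function_deriv[OF \<phi>]])
        (use l V contV1 in \<open>auto intro: has_field_derivative_at_within\<close>)
    also have "\<dots> = integral {0..l} (\<lambda>x. v x * \<phi> x)"
      by (subst integral_by_parts_test_function[OF \<phi>, where u' = v])
        (use l V1 contv in \<open>auto intro: has_field_derivative_at_within continuous_on_subset\<close>)
    finally have 2: "integral {0..l} (\<lambda>x. V x * deriv (deriv \<phi>) x) = integral {0..l} (\<lambda>x. v x * \<phi> x)" .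
    have "integral {0..l} (\<lambda>x. v x * deriv (deriv \<phi>) x + \<nu> * (V x * deriv (deriv \<phi>) x)) =
        integral {0..l} (\<lambda>x. v x * deriv (deriv \<phi>) x) + integral {0..l} (\<lambda>x. \<nu> * (V x * deriv (deriv \<phi>) x))"
      by (rule Henstock_Kurzweil_Integration.integral_add)
        (intro integrable_continuous_real continuous_intros contV continuous_on_subset[OF contv]
          smooth_continuous_on smooth subset_UNIV)+
    then show ?thesis
      using 1 2 by (simp add: w_def algebra_simps)
  qed
  define a where "a = l / 3"
  define b where "b = 2 * l / 3"
  define q where "q = (w b - w a) / (b - a)"
  have ab: "0 < a" "a < b" "b < l" using l by (auto simp: a_def b_def)
  have affine_inside: "w x = w a + q * (x - a)" if x: "x \<in> {0<..<l}" for x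
  proof -
    note three = affine_if_orthogonal_to_second_derivatives[OF contw orth]
    have "(b - a) * w x = (b - a) * w a + (w b - w a) * (x - a)"
    proof -
      \<comment> \<open>The collinearity relation needs strictly ordered points, hence a case for
        each position of \<open>x\<close>.\<close>
      consider "x = a" | "x = b" | "x < a" | "a < x" "x < b" | "b < x" by linarith
      then show ?thesis
      proof cases
        case 3
        then show ?thesis using three[of x a b] x ab by (auto simp: algebra_simps)
      next
        case 4
        then show ?thesis using three[of a x b] x ab by (auto simp: algebra_simps)
      next
        case 5
        then show ?thesis using three[of a b x] x ab by (auto simp: algebra_simps)
      qed (auto simp: algebra_simps)
    qed
    then show ?thesis using ab by (simp add: q_def field_simps)
  qed
  have w_affine: "w x = w a + q * (x - a)" if x: "x \<in> {0..l}" for x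
  proof -
    \<comment> \<open>Collinearity was available in the open interval only; continuity carries it to
      the end points.\<close>
    have "closure {0<..<l} \<subseteq> {x \<in> UNIV. w x = w a + q * (x - a)}"
    proof (rule closure_minimal)
      show "closed {x \<in> UNIV. w x = w a + q * (x - a)}"
        by (auto intro!: closed_Collect_eq continuous_intros contw)
    qed (use affine_inside in auto)
    then show ?thesis using x l by auto
  qed
  have u_eq: "u x = w a + q * (x - a) - \<nu> * V x" if "x \<in> {0..l}" for x
    using w_affine[OF that] v_eq[OF that] by (simp add: w_def)
  show thesis
  proof
    fix x assume x: "x \<in> {0..l}"
    have "((\<lambda>x. w a + q * (x - a) - \<nu> * V x) has_real_derivative q - \<nu> * V1 x) (at x within {0..l})"
      by (rule derivative_eq_intros has_field_derivative_at_within[OF V] refl | simp)+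
    then show "(u has_real_derivative q - \<nu> * V1 x) (at x within {0..l})"
      by (rule has_field_derivative_transform_within[OF _ zero_less_one x]) (use u_eq in auto)
    show "((\<lambda>x. q - \<nu> * V1 x) has_real_derivative - (\<nu> * u x)) (at x within {0..l})"
      by (rule derivative_eq_intros has_field_derivative_at_within[OF V1] refl | simp add: v_eq[OF x])+
  qed
qed

section \<open>Eigenfunctions on metric graphs\<close>

lemma path_of_length_nonneg: "path_of_length G L p q l \<Longrightarrow> 0 \<le> l"
  by (induction rule: path_of_length.induct) auto

lemma graph_dist_le:
  assumes "path_of_length G L p q l"
  shows "graph_dist G L p q \<le> l"
  unfolding graph_dist_def
  by (rule cInf_lower) (use assms path_of_length_nonneg in \<open>auto intro!: bdd_belowI[of _ 0]\<close>)

text \<open>The edgewise bounds add up along the segments of a path. Since \<open>f\<close> is a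
  function of graph points, no loss occurs where a path crosses a vertex.\<close>

lemma lipschitz_along_paths:
  assumes "path_of_length G L p q l"
    and "\<And>e s t. e \<in> arcs G \<Longrightarrow> s \<in> {0..L e} \<Longrightarrow> t \<in> {0..L e} \<Longrightarrow>
      \<bar>f (edge_point G L e t) - f (edge_point G L e s)\<bar> \<le> K * \<bar>t - s\<bar>"
  shows "\<bar>f q - f p\<bar> \<le> K * l"
  using assms(1)
proof induction
  case (trivial p)
  then show ?case by simp
next
  case (segment p e s l t)
  have "\<bar>f (edge_point G L e t) - f (edge_point G L e s)\<bar> \<le> K * \<bar>t - s\<bar>"
    using assms(2) segment by blast
  then show ?case using segment.IH by (simp add: algebra_simps)
qed

lemma path_of_length_trans:
  assumes "path_of_length G L p q l" "path_of_length G L q r m"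
  shows "path_of_length G L p r (l + m)"
  using assms(2,1)
proof (induction arbitrary: l)
  case (trivial p)
  then show ?case by simp
next
  case (segment q e s m t)
  then show ?case
    using path_of_length.segment[of G L p e s "l + m" t] by (simp add: add.assoc)
qed

context metric_graph
begin

lemma edge_point_0: "edge_point G L e 0 = Vertex (tail G e)"
  by (simp add: edge_point_def)

lemma edge_point_length: "e \<in> arcs G \<Longrightarrow> edge_point G L e (L e) = Vertex (head G e)"
  using length_pos[of e] by (simp add: edge_point_def)

lemma edge_point_in_graph_space:
  assumes "e \<in> arcs G" "x \<in> {0..L e}"
  shows "edge_point G L e x \<in> graph_space G L"
  using assms by (auto simp: edge_point_def graph_space_def)

lemma path_along_edge:
  assumes "e \<in> arcs G" "s \<in> {0..L e}" "t \<in> {0..L e}"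
  shows "path_of_length G L (edge_point G L e s) (edge_point G L e t) \<bar>t - s\<bar>"
  using path_of_length.segment[OF path_of_length.trivial[OF edge_point_in_graph_space[OF assms(1,2)]] assms]
  by simp

text \<open>Connectedness concerns the symmetrised graph, whose arcs may be traversed against their
  orientation; hence an equivalence in the step instead of an implication.\<close>

lemma verts_connected_induct:
  assumes "u \<in> verts G" "v \<in> verts G"
    and "P u"
    and "\<And>e. e \<in> arcs G \<Longrightarrow> P (tail G e) \<longleftrightarrow> P (head G e)"
  shows "P v"
proof -
  have "reachable (with_proj (mk_symmetric G)) u v"
    using connected_graph assms(1,2) unfolding connected_def strongly_connected_def by simp
  then have "(u, v) \<in> (parcs (mk_symmetric G))\<^sup>*"
    unfolding reachable_def by (auto dest: rtrancl_on_rtranclI)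
  then show ?thesis
  proof induction
    case base
    then show ?case using assms(3) .
  next
    case (step x y)
    then show ?case using assms(4) by (auto simp: parcs_mk_symmetric)
  qed
qed

lemma graph_space_path_to_vertex:
  assumes "p \<in> graph_space G L"
  obtains v l m where "v \<in> verts G" "path_of_length G L p (Vertex v) l" "path_of_length G L (Vertex v) p m"
proof -
  consider v where "v \<in> verts G" "p = Vertex v"
    | e x where "e \<in> arcs G" "0 < x" "x < L e" "p = Inner e x"
    using assms by (auto simp: graph_space_def)
  then show thesis
  proof cases
    case 1
    then show thesis using that path_of_length.trivial assms by metis
  next
    case 2
    then have p: "p = edge_point G L e x" by (simp add: edge_point_def)
    have "x \<in> {0..L e}" "0 \<in> {0..L e}" using 2 by auto
    then show thesis
      using that[of "tail G e"] path_along_edge[OF 2(1), of x 0] path_along_edge[OF 2(1), of 0 x] 2(1)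
      unfolding p edge_point_0 by auto
  qed
qed

text \<open>Ensures that the infimum defining \<open>graph_dist\<close> is taken over a nonempty
  set, so that a small distance yields a short path.\<close>

lemma path_exists:
  assumes "p \<in> graph_space G L" "q \<in> graph_space G L"
  obtains l where "path_of_length G L p q l"
proof -
  obtain u l where u: "u \<in> verts G" "path_of_length G L p (Vertex u) l"
    using graph_space_path_to_vertex[OF assms(1)] by metis
  obtain v m where v: "v \<in> verts G" "path_of_length G L (Vertex v) q m"
    using graph_space_path_to_vertex[OF assms(2)] by metis
  have "\<exists>k. path_of_length G L (Vertex u) (Vertex v) k"
  proof (rule verts_connected_induct[OF u(1) v(1)])
    show "\<exists>k. path_of_length G L (Vertex u) (Vertex u) k"
      using path_of_length.trivial[of "Vertex u" G L] u(1) by (auto simp: graph_space_def)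
  next
    fix e assume e: "e \<in> arcs G"
    have ends: "0 \<in> {0..L e}" "L e \<in> {0..L e}" using length_pos[OF e] by auto
    have "path_of_length G L (Vertex (tail G e)) (Vertex (head G e)) (L e)"
      "path_of_length G L (Vertex (head G e)) (Vertex (tail G e)) (L e)"
      using path_along_edge[OF e ends] path_along_edge[OF e ends(2,1)] length_pos[OF e]
      by (simp_all add: edge_point_0 edge_point_length e)
    then show "(\<exists>k. path_of_length G L (Vertex u) (Vertex (tail G e)) k) \<longleftrightarrow>
        (\<exists>k. path_of_length G L (Vertex u) (Vertex (head G e)) k)"
      using path_of_length_trans by metis
  qed
  then show thesis
    using that u(2) v(2) path_of_length_trans by metis
qed

lemma continuous_on_graph_if_lipschitz:
  assumes "\<And>e s t. e \<in> arcs G \<Longrightarrow> s \<in> {0..L e} \<Longrightarrow> t \<in> {0..L e} \<Longrightarrow>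
      \<bar>f (edge_point G L e t) - f (edge_point G L e s)\<bar> \<le> K * \<bar>t - s\<bar>"
    and "K \<ge> 0"
  shows "continuous_on_graph G L f"
  unfolding continuous_on_graph_def
proof (intro ballI allI impI)
  fix p and \<epsilon> :: real assume p: "p \<in> graph_space G L" and "\<epsilon> > 0"
  show "\<exists>\<delta>>0. \<forall>q\<in>graph_ball G L p \<delta>. \<bar>f q - f p\<bar> < \<epsilon>"
  \<comment> \<open>Dividing by \<open>K + 1\<close> instead of \<open>K\<close> covers the case
    \<open>K = 0\<close>.\<close>
  proof (intro exI[of _ "\<epsilon> / (K + 1)"] conjI ballI)
    show "\<epsilon> / (K + 1) > 0" using \<open>\<epsilon> > 0\<close> \<open>K \<ge> 0\<close> by simp
    fix q assume "q \<in> graph_ball G L p (\<epsilon> / (K + 1))"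
    then have q: "q \<in> graph_space G L" "graph_dist G L p q < \<epsilon> / (K + 1)"
      by (auto simp: graph_ball_def)
    have "{l. path_of_length G L p q l} \<noteq> {}"
      using path_exists[OF p q(1)] by blast
    from cInf_lessD[OF this q(2)[unfolded graph_dist_def]]
    obtain l where l: "path_of_length G L p q l" "l < \<epsilon> / (K + 1)"
      by blast
    have "\<bar>f q - f p\<bar> \<le> K * l"
      using lipschitz_along_paths[OF l(1)] assms(1) by blast
    also have "\<dots> \<le> (K + 1) * l"
      using path_of_length_nonneg[OF l(1)] by (simp add: algebra_simps)
    also have "\<dots> < \<epsilon>"
      using l(2) \<open>K \<ge> 0\<close> by (simp add: field_simps)
    finally show "\<bar>f q - f p\<bar> < \<epsilon>" .
  qed
qed

text \<open>The parametrisation of an edge does not increase distances, because the edge itself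
  contains a path of length \<open>\<bar>y - x\<bar>\<close>.\<close>

lemma continuous_on_edge:
  assumes "continuous_on_graph G L f" "e \<in> arcs G"
  shows "continuous_on {0..L e} (on_edge G L f e)"
  unfolding continuous_on_iff
proof (intro ballI allI impI)
  fix x and \<epsilon> :: real assume x: "x \<in> {0..L e}" and "\<epsilon> > 0"
  have "edge_point G L e x \<in> graph_space G L"
    by (rule edge_point_in_graph_space[OF assms(2) x])
  then obtain \<delta> where \<delta>: "\<delta> > 0"
    "\<And>q. q \<in> graph_ball G L (edge_point G L e x) \<delta> \<Longrightarrow> \<bar>f q - f (edge_point G L e x)\<bar> < \<epsilon>"
    using assms(1) \<open>\<epsilon> > 0\<close> unfolding continuous_on_graph_def by blast
  have "\<bar>f (edge_point G L e y) - f (edge_point G L e x)\<bar> < \<epsilon>" if "y \<in> {0..L e}" "\<bar>y - x\<bar> < \<delta>" for y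
  proof (rule \<delta>(2))
    show "edge_point G L e y \<in> graph_ball G L (edge_point G L e x) \<delta>"
      using graph_dist_le[OF path_along_edge[OF assms(2) x that(1)]] that
        edge_point_in_graph_space[OF assms(2) that(1)]
      by (simp add: graph_ball_def)
  qed
  then show "\<exists>\<delta>>0. \<forall>y\<in>{0..L e}. dist y x < \<delta> \<longrightarrow> dist (on_edge G L f e y) (on_edge G L f e x) < \<epsilon>"
    using \<delta>(1) by (auto simp: dist_real_def on_edge_def)
qed

section \<open>Eigenfunctions as classical solutions on edges\<close>

text \<open>Derivatives within a nondegenerate closed interval are unique, also at the end points,
  so the choice behind \<open>vector_derivative\<close> returns \<open>d\<close>.\<close>

lemma edge_derivative_eq:
  assumes "e \<in> arcs G" "x \<in> {0..L e}"
    and "(on_edge G L f e has_real_derivative d) (at x within {0..L e})"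
  shows "edge_derivative G L f e x = d"
  unfolding edge_derivative_def
  using vector_derivative_within_closed_interval[of 0 "L e" x] assms length_pos[of e]
  by (auto simp: has_real_derivative_iff_has_vector_derivative)

lemma eigenfunction_classical:
  assumes "eigenfunction G L \<nu> \<psi>" "e \<in> arcs G" "x \<in> {0..L e}"
  shows "(on_edge G L \<psi> e has_real_derivative edge_derivative G L \<psi> e x) (at x within {0..L e})"
    and "(edge_derivative G L \<psi> e has_real_derivative - (\<nu> * on_edge G L \<psi> e x)) (at x within {0..L e})"
proof -
  let ?u = "on_edge G L \<psi> e"
  have cont: "continuous_on {0..L e} ?u"
    using assms(1,2) continuous_on_edge
    by (auto simp: eigenfunction_def neg_laplacian_def laplacian_domain_def)
  have "H2_with 0 (L e) ?u (\<lambda>x. - (\<nu> * ?u x))"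
    using assms(1,2) by (auto simp: eigenfunction_def neg_laplacian_def on_edge_def)
  then obtain u' where u': "\<And>x. x \<in> {0..L e} \<Longrightarrow> (?u has_real_derivative u' x) (at x within {0..L e})"
    "\<And>x. x \<in> {0..L e} \<Longrightarrow> (u' has_real_derivative - (\<nu> * ?u x)) (at x within {0..L e})"
    using classical_if_weak_eigenfunction[OF length_pos[OF assms(2)] cont] by blast
  have eq: "edge_derivative G L \<psi> e y = u' y" if "y \<in> {0..L e}" for y
    using edge_derivative_eq[OF assms(2) that u'(1)[OF that]] .
  show "(?u has_real_derivative edge_derivative G L \<psi> e x) (at x within {0..L e})"
    using u'(1) eq assms(3) by simp
  show "(edge_derivative G L \<psi> e has_real_derivative - (\<nu> * ?u x)) (at x within {0..L e})"
    by (rule has_field_derivative_transform_within[OF u'(2)[OF assms(3)] zero_less_one assms(3)])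
      (simp add: eq)
qed

lemma on_edge_0: "on_edge G L f e 0 = f (Vertex (tail G e))"
  by (simp add: on_edge_def edge_point_0)

lemma on_edge_length: "e \<in> arcs G \<Longrightarrow> on_edge G L f e (L e) = f (Vertex (head G e))"
  by (simp add: on_edge_def edge_point_length)

text \<open>Each end of an edge lies at one vertex, so the sum regroups by vertices. There
  \<open>f\<close> has a single value, which factors out and leaves the Kirchhoff sum.\<close>

lemma sum_edge_fluxes:
  assumes "\<And>v. v \<in> verts G \<Longrightarrow> kirchhoff_at G L f v"
  shows "(\<Sum>e\<in>arcs G. f (Vertex (head G e)) * edge_derivative G L f e (L e) -
    f (Vertex (tail G e)) * edge_derivative G L f e 0) = 0"
proof -
  have "(\<Sum>e\<in>arcs G. f (Vertex (head G e)) * edge_derivative G L f e (L e)) =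
      (\<Sum>v\<in>verts G. \<Sum>e\<in>in_arcs G v. f (Vertex (head G e)) * edge_derivative G L f e (L e))"
    unfolding in_arcs_def by (rule sum.group[symmetric]) auto
  also have "\<dots> = (\<Sum>v\<in>verts G. f (Vertex v) * (\<Sum>e\<in>in_arcs G v. edge_derivative G L f e (L e)))"
    by (simp add: sum_distrib_left)
  finally have head: "(\<Sum>e\<in>arcs G. f (Vertex (head G e)) * edge_derivative G L f e (L e)) =
      (\<Sum>v\<in>verts G. f (Vertex v) * (\<Sum>e\<in>in_arcs G v. edge_derivative G L f e (L e)))" .
  have "(\<Sum>e\<in>arcs G. f (Vertex (tail G e)) * edge_derivative G L f e 0) =
      (\<Sum>v\<in>verts G. \<Sum>e\<in>out_arcs G v. f (Vertex (tail G e)) * edge_derivative G L f e 0)"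
    unfolding out_arcs_def by (rule sum.group[symmetric]) auto
  also have "\<dots> = (\<Sum>v\<in>verts G. f (Vertex v) * (\<Sum>e\<in>out_arcs G v. edge_derivative G L f e 0))"
    by (simp add: sum_distrib_left)
  finally have tail: "(\<Sum>e\<in>arcs G. f (Vertex (tail G e)) * edge_derivative G L f e 0) =
      (\<Sum>v\<in>verts G. f (Vertex v) * (\<Sum>e\<in>out_arcs G v. edge_derivative G L f e 0))" .
  show ?thesis
    using assms unfolding sum_subtractf head tail kirchhoff_at_def by simp
qed

lemma eigenfunction_kirchhoff:
  "eigenfunction G L \<nu> \<psi> \<Longrightarrow> v \<in> verts G \<Longrightarrow> kirchhoff_at G L \<psi> v"
  by (simp add: eigenfunction_def neg_laplacian_def laplacian_domain_def)

lemma constant_on_graph: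
  assumes "\<And>e x. e \<in> arcs G \<Longrightarrow> x \<in> {0..L e} \<Longrightarrow> on_edge G L f e x = on_edge G L f e 0"
  obtains c where "\<And>p. p \<in> graph_space G L \<Longrightarrow> f p = c"
proof -
  obtain u where u: "u \<in> verts G"
    using connected_graph unfolding connected_def strongly_connected_def by auto
  have vertex: "f (Vertex v) = f (Vertex u)" if "v \<in> verts G" for v
  proof (rule verts_connected_induct[OF u that])
    fix e assume e: "e \<in> arcs G"
    have "on_edge G L f e (L e) = on_edge G L f e 0"
      using length_pos[OF e] by (intro assms e) auto
    then show "f (Vertex (tail G e)) = f (Vertex u) \<longleftrightarrow> f (Vertex (head G e)) = f (Vertex u)"
      using e by (simp add: on_edge_0 on_edge_length)
  qed simp
  have "f p = f (Vertex u)" if p: "p \<in> graph_space G L" for p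
  proof -
    consider v where "v \<in> verts G" "p = Vertex v"
      | e x where "e \<in> arcs G" "0 < x" "x < L e" "p = Inner e x"
      using p by (auto simp: graph_space_def)
    then show ?thesis
    proof cases
      case 1
      then show ?thesis using vertex by simp
    next
      case 2
      then have "f p = on_edge G L f e x" by (simp add: on_edge_def edge_point_def)
      also have "\<dots> = f (Vertex (tail G e))" using assms[of e x] 2 by (simp add: on_edge_0)
      finally show ?thesis using vertex 2(1) by simp
    qed
  qed
  then show thesis using that by blast
qed

text \<open>Energy identity: on each edge the integral of \<open>u'^2 - \<nu> u^2\<close> is the
  boundary term of \<open>u u'\<close>. These terms sum to zero, and for
  \<open>\<nu> \<le> 0\<close> none is negative; so the integrand vanishes everywhere, and with it
  \<open>u'\<close>.\<close>

lemma nonpositive_eigenfunction_constant: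
  assumes \<psi>: "eigenfunction G L \<nu> \<psi>" and "\<nu> \<le> 0"
  obtains c where "\<And>p. p \<in> graph_space G L \<Longrightarrow> \<psi> p = c"
proof (rule constant_on_graph)
  let ?u = "on_edge G L \<psi>" and ?D = "edge_derivative G L \<psi>"
  let ?E = "\<lambda>e x. (?D e x)\<^sup>2 - \<nu> * (?u e x)\<^sup>2"
  let ?flux = "\<lambda>e. ?u e (L e) * ?D e (L e) - ?u e 0 * ?D e 0"
  have cont: "continuous_on {0..L e} (?u e)" "continuous_on {0..L e} (?D e)" if "e \<in> arcs G" for e
    by (rule DERIV_continuous_on, rule eigenfunction_classical[OF \<psi> that], assumption)+
  have energy: "(?E e has_integral ?flux e) {0..L e}" if e: "e \<in> arcs G" for e
  proof (rule fundamental_theorem_of_calculus)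
    fix x assume x: "x \<in> {0..L e}"
    have "((\<lambda>x. ?u e x * ?D e x) has_real_derivative ?E e x) (at x within {0..L e})"
      using DERIV_mult'[OF eigenfunction_classical[OF \<psi> e x]]
      by (simp add: power2_eq_square algebra_simps)
    then show "((\<lambda>x. ?u e x * ?D e x) has_vector_derivative ?E e x) (at x within {0..L e})"
      by (simp add: has_real_derivative_iff_has_vector_derivative)
  qed (use length_pos[OF e] in simp)
  have E_nonneg: "?E e x \<ge> 0" for e x
    using mult_nonpos_nonneg[OF \<open>\<nu> \<le> 0\<close> zero_le_power2[of "?u e x"]] zero_le_power2[of "?D e x"] by linarith
  have flux_nonneg: "?flux e \<ge> 0" if "e \<in> arcs G" for e
    using has_integral_nonneg[OF energy[OF that]] E_nonneg by blast
  have "(\<Sum>e\<in>arcs G. ?flux e) = 0"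
    using sum_edge_fluxes[of \<psi>] eigenfunction_kirchhoff[OF \<psi>]
    by (simp add: on_edge_0 on_edge_length cong: sum.cong)
  then have flux_0: "?flux e = 0" if "e \<in> arcs G" for e
    using sum_nonneg_eq_0_iff[of "arcs G" ?flux] flux_nonneg that by auto
  fix e x assume e: "e \<in> arcs G" and x: "x \<in> {0..L e}"
  have E_0: "?E e y = 0" if "y \<in> {0..L e}" for y
  proof -
    have "integral {0..L e} (?E e) = 0"
      using integral_unique[OF energy[OF e]] flux_0[OF e] by simp
    moreover have "continuous_on {0..L e} (?E e)"
      by (intro continuous_intros cont e)
    ultimately show ?thesis
      using integral_eq_0_iff[of 0 "L e" "?E e"] length_pos[OF e] E_nonneg that by blast
  qed
  have D_0: "?D e y = 0" if "y \<in> {0..L e}" for y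
  proof -
    have "(?D e y)\<^sup>2 \<le> 0"
      using E_0[OF that] mult_nonpos_nonneg[OF \<open>\<nu> \<le> 0\<close> zero_le_power2[of "?u e y"]] by linarith
    then show ?thesis by simp
  qed
  have "\<exists>c. \<forall>y\<in>{0..L e}. ?u e y = c"
    by (rule has_field_derivative_zero_constant)
      (use eigenfunction_classical(1)[OF \<psi> e] D_0 in auto)
  then show "?u e x = ?u e 0"
    using x by auto
qed (rule that)

section \<open>Positive eigenvalues and the vertex equations\<close>

text \<open>Rotating the phase vector \<open>(k u, u')\<close> by the angle \<open>k x\<close> gives
  the pair \<open>?P\<close>, \<open>?Q\<close>, whose derivatives vanish. Their values at 0 are the
  initial data, and rotating back yields both formulas.\<close>

lemma positive_eigenfunction_on_edge:
  assumes \<psi>: "eigenfunction G L (k\<^sup>2) \<psi>" and e: "e \<in> arcs G" and "k > 0" and x: "x \<in> {0..L e}"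
  shows "k * on_edge G L \<psi> e x =
      k * on_edge G L \<psi> e 0 * cos (k * x) + edge_derivative G L \<psi> e 0 * sin (k * x)"
    and "edge_derivative G L \<psi> e x =
      edge_derivative G L \<psi> e 0 * cos (k * x) - k * on_edge G L \<psi> e 0 * sin (k * x)"
proof -
  let ?u = "on_edge G L \<psi> e" and ?D = "edge_derivative G L \<psi> e"
  let ?P = "\<lambda>x. k * ?u x * cos (k * x) - ?D x * sin (k * x)"
  let ?Q = "\<lambda>x. k * ?u x * sin (k * x) + ?D x * cos (k * x)"
  note d = eigenfunction_classical[OF \<psi> e]
  have "(?P has_real_derivative 0) (at y within {0..L e})" if "y \<in> {0..L e}" for y
    by (rule derivative_eq_intros d that refl)+ (simp add: algebra_simps power2_eq_square)
  then have "\<exists>c. \<forall>y\<in>{0..L e}. ?P y = c"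
    by (intro has_field_derivative_zero_constant) auto
  moreover have "0 \<in> {0..L e}" using x by auto
  ultimately have P: "?P x = k * ?u 0"
    using x by force
  have "(?Q has_real_derivative 0) (at y within {0..L e})" if "y \<in> {0..L e}" for y
    by (rule derivative_eq_intros d that refl)+ (simp add: algebra_simps power2_eq_square)
  then have "\<exists>c. \<forall>y\<in>{0..L e}. ?Q y = c"
    by (intro has_field_derivative_zero_constant) auto
  moreover have "0 \<in> {0..L e}" using x by auto
  ultimately have Q: "?Q x = ?D 0"
    using x by force
  have "k * ?u x = k * ?u x * ((sin (k * x))\<^sup>2 + (cos (k * x))\<^sup>2)" by simp
  also have "\<dots> = ?P x * cos (k * x) + ?Q x * sin (k * x)" by algebra
  finally show "k * ?u x = k * ?u 0 * cos (k * x) + ?D 0 * sin (k * x)"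
    unfolding P Q .
  have "?D x = ?D x * ((sin (k * x))\<^sup>2 + (cos (k * x))\<^sup>2)" by simp
  also have "\<dots> = ?Q x * cos (k * x) - ?P x * sin (k * x)" by algebra
  finally show "?D x = ?D 0 * cos (k * x) - k * ?u 0 * sin (k * x)"
    unfolding P Q .
qed

text \<open>Neighbours are counted with multiplicity: parallel edges count separately, and a loop at
  \<open>v\<close> contributes \<open>a v\<close> twice.\<close>

definition neighbour_sum :: "('v \<Rightarrow> real) \<Rightarrow> 'v \<Rightarrow> real" where
  "neighbour_sum a v = (\<Sum>e\<in>in_arcs G v. a (tail G e)) + (\<Sum>e\<in>out_arcs G v. a (head G e))"

text \<open>Multiplied by \<open>sin (k * l)\<close>, the end derivatives become linear expressions
  in the vertex values, and the Kirchhoff condition turns into an equation between these. As nothing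
  is divided by the sine, it may vanish here.\<close>

lemma eigenfunction_vertex_equation:
  assumes \<psi>: "eigenfunction G L (k\<^sup>2) \<psi>" and "k > 0" and v: "v \<in> verts G"
    and len: "\<And>e. e \<in> arcs G \<Longrightarrow> L e = l"
  shows "real (in_degree G v + out_degree G v) * cos (k * l) * \<psi> (Vertex v) =
    neighbour_sum (\<lambda>w. \<psi> (Vertex w)) v"
proof -
  let ?a = "\<lambda>w. \<psi> (Vertex w)" and ?D = "edge_derivative G L \<psi>"
  let ?s = "sin (k * l)" and ?c = "cos (k * l)"
  have D0: "?D e 0 * ?s = k * (?a (head G e) - ?a (tail G e) * ?c)" if e: "e \<in> arcs G" for e
    using positive_eigenfunction_on_edge(1)[OF \<psi> e \<open>k > 0\<close>, of "L e"] length_pos[OF e]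
      on_edge_length[OF e] on_edge_0[of \<psi> e] len[OF e] by (simp add: algebra_simps)
  have DL: "?D e l * ?s = k * (?a (head G e) * ?c - ?a (tail G e))" if e: "e \<in> arcs G" for e
  proof -
    have "?D e l = ?D e 0 * ?c - k * ?a (tail G e) * ?s"
      using positive_eigenfunction_on_edge(2)[OF \<psi> e \<open>k > 0\<close>, of "L e"] length_pos[OF e]
        on_edge_0[of \<psi> e] len[OF e] by simp
    then have "?D e l * ?s = (?D e 0 * ?s) * ?c - k * ?a (tail G e) * ?s\<^sup>2"
      by algebra
    also have "\<dots> = k * (?a (head G e) * ?c - ?a (tail G e) * (?s\<^sup>2 + ?c\<^sup>2))"
      unfolding D0[OF e] by algebra
    finally show ?thesis by simp
  qed
  have "((\<Sum>e\<in>in_arcs G v. ?D e (L e)) - (\<Sum>e\<in>out_arcs G v. ?D e 0)) * ?s = 0"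
    using eigenfunction_kirchhoff[OF \<psi> v] by (simp add: kirchhoff_at_def)
  moreover have "(\<Sum>e\<in>in_arcs G v. ?D e (L e)) * ?s =
      k * (real (in_degree G v) * (?a v * ?c) - (\<Sum>e\<in>in_arcs G v. ?a (tail G e)))"
  proof -
    have "(\<Sum>e\<in>in_arcs G v. ?D e (L e)) * ?s = (\<Sum>e\<in>in_arcs G v. k * (?a v * ?c - ?a (tail G e)))"
      unfolding sum_distrib_right by (rule sum.cong) (auto simp: len DL)
    also have "\<dots> = k * (real (in_degree G v) * (?a v * ?c) - (\<Sum>e\<in>in_arcs G v. ?a (tail G e)))"
      unfolding sum_distrib_left[symmetric] sum_subtractf by (simp add: in_degree_def)
    finally show ?thesis .
  qed
  moreover have "(\<Sum>e\<in>out_arcs G v. ?D e 0) * ?s =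
      k * ((\<Sum>e\<in>out_arcs G v. ?a (head G e)) - real (out_degree G v) * (?a v * ?c))"
  proof -
    have "(\<Sum>e\<in>out_arcs G v. ?D e 0) * ?s = (\<Sum>e\<in>out_arcs G v. k * (?a (head G e) - ?a v * ?c))"
      unfolding sum_distrib_right by (rule sum.cong) (auto simp: D0)
    also have "\<dots> = k * ((\<Sum>e\<in>out_arcs G v. ?a (head G e)) - real (out_degree G v) * (?a v * ?c))"
      unfolding sum_distrib_left[symmetric] sum_subtractf by (simp add: out_degree_def)
    finally show ?thesis .
  qed
  ultimately have "k * (real (in_degree G v) * (?a v * ?c) - (\<Sum>e\<in>in_arcs G v. ?a (tail G e))) =
      k * ((\<Sum>e\<in>out_arcs G v. ?a (head G e)) - real (out_degree G v) * (?a v * ?c))"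
    by (simp only: left_diff_distrib)
  then have "real (in_degree G v) * (?a v * ?c) - (\<Sum>e\<in>in_arcs G v. ?a (tail G e)) =
      (\<Sum>e\<in>out_arcs G v. ?a (head G e)) - real (out_degree G v) * (?a v * ?c)"
    using \<open>k > 0\<close> by (simp only: mult_cancel_left) simp
  then show ?thesis
    by (simp add: neighbour_sum_def algebra_simps)
qed

text \<open>An edge solution with zero end values is a multiple of \<open>sin (k * x)\<close> that
  vanishes at \<open>L e\<close>; the nonzero sine there leaves only the zero solution.\<close>

lemma no_eigenfunction_vanishing_on_vertices:
  assumes \<psi>: "eigenfunction G L (k\<^sup>2) \<psi>" and "k > 0"
    and sin: "\<And>e. e \<in> arcs G \<Longrightarrow> sin (k * L e) \<noteq> 0"
    and zero: "\<And>v. v \<in> verts G \<Longrightarrow> \<psi> (Vertex v) = 0"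
  shows False
proof -
  have edge: "on_edge G L \<psi> e x = 0" if e: "e \<in> arcs G" and x: "x \<in> {0..L e}" for e x
  proof -
    have ends: "on_edge G L \<psi> e 0 = 0" "on_edge G L \<psi> e (L e) = 0"
      using zero e by (simp_all add: on_edge_0 on_edge_length)
    have "edge_derivative G L \<psi> e 0 = 0"
      using positive_eigenfunction_on_edge(1)[OF \<psi> e \<open>k > 0\<close>, of "L e"] ends sin[OF e] length_pos[OF e]
      by simp
    then show ?thesis
      using positive_eigenfunction_on_edge(1)[OF \<psi> e \<open>k > 0\<close> x] ends \<open>k > 0\<close> by simp
  qed
  then obtain c where c: "\<And>p. p \<in> graph_space G L \<Longrightarrow> \<psi> p = c"
    using constant_on_graph[of \<psi>] length_pos by (metis atLeastAtMost_iff less_eq_real_def order_refl)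
  obtain u where "u \<in> verts G"
    using connected_graph unfolding connected_def strongly_connected_def by auto
  then have "c = 0"
    using c[of "Vertex u"] zero by (simp add: graph_space_def)
  then show False
    using \<psi> c unfolding eigenfunction_def by blast
qed

end

section \<open>Trigonometric eigenfunctions and the second eigenvalue\<close>

lemma trig_lipschitz:
  fixes a b k :: real
  shows "\<bar>(a * cos (k * t) + b * sin (k * t)) - (a * cos (k * s) + b * sin (k * s))\<bar>
    \<le> \<bar>k\<bar> * (\<bar>a\<bar> + \<bar>b\<bar>) * \<bar>t - s\<bar>"
proof -
  have "((\<lambda>x. a * cos (k * x) + b * sin (k * x)) has_real_derivative k * (b * cos (k * x) - a * sin (k * x))) (at x within UNIV)" for x
    by (rule derivative_eq_intros refl | simp add: algebra_simps)+
  moreover have "norm (k * (b * cos (k * x) - a * sin (k * x))) \<le> \<bar>k\<bar> * (\<bar>a\<bar> + \<bar>b\<bar>)" for x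
  proof -
    have "\<bar>b * cos (k * x)\<bar> \<le> \<bar>b\<bar>" "\<bar>a * sin (k * x)\<bar> \<le> \<bar>a\<bar>"
      by (simp_all add: abs_mult mult_left_le)
    then have "\<bar>b * cos (k * x) - a * sin (k * x)\<bar> \<le> \<bar>a\<bar> + \<bar>b\<bar>"
      by linarith
    then show ?thesis
      by (simp add: abs_mult mult_left_mono)
  qed
  ultimately show ?thesis
    using field_differentiable_bound[of UNIV "\<lambda>x. a * cos (k * x) + b * sin (k * x)"
        "\<lambda>x. k * (b * cos (k * x) - a * sin (k * x))" "\<bar>k\<bar> * (\<bar>a\<bar> + \<bar>b\<bar>)" t s]
    by simp
qed

text \<open>Cauchy-Schwarz with the unit vector \<open>(cos t, sin t)\<close>, obtained from the
  Lagrange identity.\<close>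

lemma trig_le_1:
  fixes a b t :: real
  assumes "a\<^sup>2 + b\<^sup>2 \<le> 1"
  shows "a * cos t + b * sin t \<le> 1"
proof -
  have "(a * cos t + b * sin t)\<^sup>2 + (a * sin t - b * cos t)\<^sup>2 = (a\<^sup>2 + b\<^sup>2) * ((sin t)\<^sup>2 + (cos t)\<^sup>2)"
    by algebra
  then have "(a * cos t + b * sin t)\<^sup>2 + (a * sin t - b * cos t)\<^sup>2 \<le> 1"
    using assms by simp
  then have "(a * cos t + b * sin t)\<^sup>2 \<le> 1\<^sup>2"
    using zero_le_power2[of "a * sin t - b * cos t"] unfolding one_power2 by linarith
  then show ?thesis
    by (rule power2_le_imp_le) simp
qed

context metric_graph
begin

text \<open>The cosine coefficient of an edge is the value at its tail. Indexing it by vertices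
  makes the function agree at all tails automatically, so that only the heads need a compatibility
  condition.\<close>

definition trig_function :: "real \<Rightarrow> ('v \<Rightarrow> real) \<Rightarrow> ('e \<Rightarrow> real) \<Rightarrow> ('v, 'e) graph_point \<Rightarrow> real" where
  "trig_function k a b p = (case p of
     Vertex v \<Rightarrow> a v
   | Inner e x \<Rightarrow> a (tail G e) * cos (k * x) + b e * sin (k * x))"

lemma on_edge_trig_function:
  assumes "a (head G e) = a (tail G e) * cos (k * L e) + b e * sin (k * L e)"
  shows "on_edge G L (trig_function k a b) e x = a (tail G e) * cos (k * x) + b e * sin (k * x)"
  using assms by (simp add: on_edge_def edge_point_def trig_function_def)

text \<open>\<open>ends\<close> is continuity at the heads, and \<open>kirchhoff\<close> is the
  Kirchhoff condition with the common factor \<open>k\<close> of all derivatives removed.\<close>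

lemma eigenfunction_trig_function:
  assumes ends: "\<And>e. e \<in> arcs G \<Longrightarrow> a (head G e) = a (tail G e) * cos (k * L e) + b e * sin (k * L e)"
    and kirchhoff: "\<And>v. v \<in> verts G \<Longrightarrow>
      (\<Sum>e\<in>in_arcs G v. b e * cos (k * L e) - a (tail G e) * sin (k * L e)) = (\<Sum>e\<in>out_arcs G v. b e)"
    and nonzero: "\<exists>p\<in>graph_space G L. trig_function k a b p \<noteq> 0"
  shows "eigenfunction G L (k\<^sup>2) (trig_function k a b)"
proof -
  let ?\<psi> = "trig_function k a b"
  define d where "d e x = k * (b e * cos (k * x) - a (tail G e) * sin (k * x))" for e x
  have edge: "on_edge G L ?\<psi> e = (\<lambda>x. a (tail G e) * cos (k * x) + b e * sin (k * x))" if "e \<in> arcs G" for e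
    using on_edge_trig_function[of a e k b, OF ends[OF that]] by (rule ext)
  have d1: "(on_edge G L ?\<psi> e has_real_derivative d e x) (at x within {0..L e})" if "e \<in> arcs G" for e x
    unfolding edge[OF that] d_def by (rule derivative_eq_intros refl | simp add: algebra_simps)+
  have d2: "(d e has_real_derivative - (k\<^sup>2 * on_edge G L ?\<psi> e x)) (at x within {0..L e})" if "e \<in> arcs G" for e x
    unfolding edge[OF that] d_def
    by (rule derivative_eq_intros refl | simp add: algebra_simps power2_eq_square)+
  have H2: "H2_with 0 (L e) (on_edge G L ?\<psi> e) (\<lambda>x. - (k\<^sup>2 * on_edge G L ?\<psi> e x))" if e: "e \<in> arcs G" for e
  proof (rule H2_with_if_classical[OF _ d1[OF e] d2[OF e]])
    show "continuous_on {0..L e} (\<lambda>x. - (k\<^sup>2 * on_edge G L ?\<psi> e x))"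
      unfolding edge[OF e] by (intro continuous_intros)
  qed (use length_pos[OF e] in simp)
  \<comment> \<open>One Lipschitz constant for the whole graph: the sum over the finitely many edges
    dominates each summand.\<close>
  define K where "K = (\<Sum>e\<in>arcs G. \<bar>k\<bar> * (\<bar>a (tail G e)\<bar> + \<bar>b e\<bar>))"
  have "continuous_on_graph G L ?\<psi>"
  proof (rule continuous_on_graph_if_lipschitz)
    show "K \<ge> 0" unfolding K_def by (intro sum_nonneg) auto
    fix e s t assume e: "e \<in> arcs G" and "s \<in> {0..L e}" "t \<in> {0..L e}"
    have "\<bar>on_edge G L ?\<psi> e t - on_edge G L ?\<psi> e s\<bar> \<le> \<bar>k\<bar> * (\<bar>a (tail G e)\<bar> + \<bar>b e\<bar>) * \<bar>t - s\<bar>"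
      unfolding edge[OF e] by (rule trig_lipschitz)
    also have "\<dots> \<le> K * \<bar>t - s\<bar>"
      unfolding K_def using e by (intro mult_right_mono member_le_sum) auto
    finally show "\<bar>?\<psi> (edge_point G L e t) - ?\<psi> (edge_point G L e s)\<bar> \<le> K * \<bar>t - s\<bar>"
      by (simp add: on_edge_def)
  qed
  moreover have "kirchhoff_at G L ?\<psi> v" if v: "v \<in> verts G" for v
  proof -
    have "(\<Sum>e\<in>in_arcs G v. edge_derivative G L ?\<psi> e (L e)) = (\<Sum>e\<in>in_arcs G v. d e (L e))"
      by (rule sum.cong) (auto intro!: edge_derivative_eq d1 simp: length_pos less_imp_le)
    also have "\<dots> = k * (\<Sum>e\<in>in_arcs G v. b e * cos (k * L e) - a (tail G e) * sin (k * L e))"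
      by (simp add: d_def sum_distrib_left)
    also have "\<dots> = (\<Sum>e\<in>out_arcs G v. d e 0)"
      unfolding kirchhoff[OF v] by (simp add: d_def sum_distrib_left)
    also have "\<dots> = (\<Sum>e\<in>out_arcs G v. edge_derivative G L ?\<psi> e 0)"
      by (rule sum.cong) (auto intro!: edge_derivative_eq[symmetric] d1 simp: length_pos less_imp_le)
    finally show ?thesis
      by (simp add: kirchhoff_at_def)
  qed
  moreover have "H2_with 0 (L e) (on_edge G L ?\<psi> e) (\<lambda>x. - on_edge G L (\<lambda>p. k\<^sup>2 * ?\<psi> p) e x)"
    if "e \<in> arcs G" for e
    using H2[OF that] by (simp add: on_edge_def)
  ultimately show ?thesis
    using H2 nonzero
    unfolding eigenfunction_def neg_laplacian_def laplacian_domain_def H2_def by blast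
qed

lemma eigenfunction_one: "eigenfunction G L 0 (\<lambda>p. 1)"
proof -
  have one: "trig_function 0 (\<lambda>_. 1) (\<lambda>_. 0) = (\<lambda>p. 1)"
    by (auto simp: trig_function_def split: graph_point.split)
  obtain u where "u \<in> verts G"
    using connected_graph unfolding connected_def strongly_connected_def by auto
  then have "Vertex u \<in> graph_space G L"
    by (simp add: graph_space_def)
  then show ?thesis
    using eigenfunction_trig_function[of "\<lambda>_. 1" 0 "\<lambda>_. 0"] one by auto
qed

section \<open>The second eigenvalue\<close>

text \<open>A constant \<open>c\<close> has zero second derivative, so \<open>\<mu> * c = 0\<close>
  on the given edge, whereas an eigenfunction is not identically zero.\<close>

lemma eigenfunction_not_constant:
  assumes \<psi>: "eigenfunction G L \<mu> \<psi>" and "\<mu> \<noteq> 0" and e: "e \<in> arcs G"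
  shows "\<not> (\<forall>p\<in>graph_space G L. \<psi> p = c)"
proof
  assume const: "\<forall>p\<in>graph_space G L. \<psi> p = c"
  have edge: "on_edge G L \<psi> e x = c" if "x \<in> {0..L e}" for x
    using const edge_point_in_graph_space[OF e that] by (simp add: on_edge_def)
  have D: "edge_derivative G L \<psi> e x = 0" if x: "x \<in> {0..L e}" for x
    by (rule edge_derivative_eq[OF e x],
        rule has_field_derivative_transform_within[OF DERIV_const[of c] zero_less_one x])
      (simp add: edge)
  have pos: "0 < L e" and 0: "0 \<in> {0..L e}"
    using length_pos[OF e] by auto
  have "(edge_derivative G L \<psi> e has_real_derivative 0) (at 0 within {0..L e})"
    by (rule has_field_derivative_transform_within[OF DERIV_const[of 0] zero_less_one 0]) (simp add: D)
  moreover have "(edge_derivative G L \<psi> e has_real_derivative - (\<mu> * c)) (at 0 within {0..L e})"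
    using eigenfunction_classical(2)[OF \<psi> e 0] edge[OF 0] by simp
  ultimately have "- (\<mu> * c) = 0"
    using vector_derivative_within_closed_interval[OF pos 0]
    unfolding has_real_derivative_iff_has_vector_derivative by metis
  then have "c = 0" using \<open>\<mu> \<noteq> 0\<close> by simp
  then show False
    using \<psi> const by (auto simp: eigenfunction_def)
qed

text \<open>The constant 1 and \<open>\<psi>\<close> show that \<open>\<mu>\<close> belongs to the
  set; any smaller bound would admit only constants, and two constants are dependent.\<close>

lemma mu_2_eq:
  assumes \<psi>: "eigenfunction G L \<mu> \<psi>" and "\<mu> > 0" and e: "e \<in> arcs G"
    and below: "\<And>\<nu> \<phi>. eigenfunction G L \<nu> \<phi> \<Longrightarrow> \<nu> < \<mu> \<Longrightarrow> \<exists>c. \<forall>p\<in>graph_space G L. \<phi> p = c"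
  shows "mu G L 2 = \<mu>"
  unfolding mu_def
proof (rule cInf_eq_minimum)
  let ?f = "\<lambda>i p. if i = (0::nat) then 1 else \<psi> p"
  have "independent_on_graph G L 2 ?f"
    unfolding independent_on_graph_def
  proof (intro allI impI)
    fix c :: "nat \<Rightarrow> real" and i :: nat
    assume "\<forall>p\<in>graph_space G L. (\<Sum>i<2. c i * ?f i p) = 0" and i: "i < 2"
    then have eq: "\<forall>p\<in>graph_space G L. c 0 + c 1 * \<psi> p = 0"
      by (simp add: numeral_2_eq_2)
    have c1: "c 1 = 0"
    proof (rule ccontr)
      assume c1: "c 1 \<noteq> 0"
      have "\<psi> p = - c 0 / c 1" if "p \<in> graph_space G L" for p
        using bspec[OF eq that] c1 by (simp add: field_simps)
      then show False
        using eigenfunction_not_constant[OF \<psi> _ e] \<open>\<mu> > 0\<close> by blast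
    qed
    have "c 0 = 0"
      using eq c1 \<psi> unfolding eigenfunction_def by auto
    then show "c i = 0"
      using c1 i by (cases i) auto
  qed
  moreover have "\<exists>\<nu>\<le>\<mu>. eigenfunction G L \<nu> (?f i)" for i
    using \<psi> eigenfunction_one \<open>\<mu> > 0\<close> by (cases "i = 0") (auto intro: exI[of _ 0])
  ultimately show "\<mu> \<in> {\<mu>. \<exists>\<psi>. independent_on_graph G L 2 \<psi> \<and> (\<forall>i<2. \<exists>\<nu>\<le>\<mu>. eigenfunction G L \<nu> (\<psi> i))}"
    by blast
next
  fix \<mu>' assume "\<mu>' \<in> {\<mu>. \<exists>\<psi>. independent_on_graph G L 2 \<psi> \<and> (\<forall>i<2. \<exists>\<nu>\<le>\<mu>. eigenfunction G L \<nu> (\<psi> i))}"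
  then obtain f where ind: "independent_on_graph G L 2 f"
    and ef: "\<And>i. i < 2 \<Longrightarrow> \<exists>\<nu>\<le>\<mu>'. eigenfunction G L \<nu> (f i)"
    by blast
  show "\<mu> \<le> \<mu>'"
  proof (rule ccontr)
    assume "\<not> \<mu> \<le> \<mu>'"
    then have const: "\<exists>c. \<forall>p\<in>graph_space G L. f i p = c" if "i < 2" for i
      using ef[OF that] below by force
    obtain c0 where c0: "\<forall>p\<in>graph_space G L. f 0 p = c0" using const[of 0] by auto
    obtain c1 where c1: "\<forall>p\<in>graph_space G L. f 1 p = c1" using const[of 1] by auto
    \<comment> \<open>These coefficients cancel any two constants:
      \<open>c1 * c0 - c0 * c1 = 0\<close>.\<close>
    let ?c = "\<lambda>i::nat. if i = 0 then c1 else - c0"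
    have "\<forall>p\<in>graph_space G L. (\<Sum>i<2. ?c i * f i p) = 0"
      using c0 c1 by (simp add: numeral_2_eq_2)
    from mp[OF spec[OF ind[unfolded independent_on_graph_def], of ?c] this]
    have "\<forall>i<2. ?c i = 0" .
    then have "c0 = 0"
      by (auto dest: spec[of _ 1])
    then show False
      using ef[of 0] c0 by (auto simp: eigenfunction_def)
  qed
qed

text \<open>The peak value is normalised to 1: being nonzero, it lets the same eigenfunction serve
  for \<open>M\<close> and for \<open>M_loc\<close>. Peaks are only asked for in edge coordinates,
  since \<open>cover\<close> puts every vertex at the end of an edge.\<close>

lemma M_eq_M_loc_eq_graph_space:
  assumes "\<mu> > 0"
    and cover: "\<And>v. v \<in> verts G \<Longrightarrow> \<exists>e\<in>arcs G. v = tail G e \<or> v = head G e"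
    and below: "\<And>\<nu> \<phi>. eigenfunction G L \<nu> \<phi> \<Longrightarrow> \<nu> < \<mu> \<Longrightarrow> \<exists>c. \<forall>p\<in>graph_space G L. \<phi> p = c"
    and peak: "\<And>e x. e \<in> arcs G \<Longrightarrow> x \<in> {0..L e} \<Longrightarrow> \<exists>\<psi>. eigenfunction G L \<mu> \<psi> \<and>
      on_edge G L \<psi> e x = 1 \<and> (\<forall>e'\<in>arcs G. \<forall>y\<in>{0..L e'}. on_edge G L \<psi> e' y \<le> 1)"
  shows "M G L = M_loc G L \<and> M_loc G L = graph_space G L"
proof -
  have point: "\<exists>e\<in>arcs G. \<exists>x\<in>{0..L e}. p = edge_point G L e x" if p: "p \<in> graph_space G L" for p
  proof -
    consider v where "v \<in> verts G" "p = Vertex v"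
      | e x where "e \<in> arcs G" "0 < x" "x < L e" "p = Inner e x"
      using p by (auto simp: graph_space_def)
    then show ?thesis
    proof cases
      case 1
      then obtain e where e: "e \<in> arcs G" "v = tail G e \<or> v = head G e"
        using cover by blast
      have "0 \<in> {0..L e}" "L e \<in> {0..L e}" using length_pos[OF e(1)] by auto
      then show ?thesis
        using e 1(2) edge_point_0[of e] edge_point_length[OF e(1)] by metis
    next
      case 2
      then have "p = edge_point G L e x" "x \<in> {0..L e}" by (simp_all add: edge_point_def)
      then show ?thesis using 2(1) by blast
    qed
  qed
  obtain u where "u \<in> verts G"
    using connected_graph unfolding connected_def strongly_connected_def by auto
  then obtain e where e: "e \<in> arcs G"
    using cover by blast
  have "0 \<in> {0..L e}" using length_pos[OF e] by simp
  then obtain \<psi> where "eigenfunction G L \<mu> \<psi>"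
    using peak[OF e] by blast
  then have mu: "mu G L 2 = \<mu>"
    using mu_2_eq \<open>\<mu> > 0\<close> e below by blast
  have peak_at: "\<exists>\<psi>. eigenfunction G L (mu G L 2) \<psi> \<and> \<psi> p = 1 \<and> (\<forall>q\<in>graph_space G L. \<psi> q \<le> 1)"
    if p: "p \<in> graph_space G L" for p
  proof -
    obtain e x where ex: "e \<in> arcs G" "x \<in> {0..L e}" "p = edge_point G L e x"
      using point[OF p] by blast
    obtain \<psi> where \<psi>: "eigenfunction G L \<mu> \<psi>" "on_edge G L \<psi> e x = 1"
      "\<forall>e'\<in>arcs G. \<forall>y\<in>{0..L e'}. on_edge G L \<psi> e' y \<le> 1"
      using peak[OF ex(1,2)] by blast
    have "\<psi> q \<le> 1" if "q \<in> graph_space G L" for q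
      using point[OF that] \<psi>(3) by (auto simp: on_edge_def)
    then show ?thesis
      using \<psi>(1,2) ex(3) mu by (auto simp: on_edge_def)
  qed
  have "p \<in> M G L \<and> p \<in> M_loc G L" if p: "p \<in> graph_space G L" for p
  proof -
    obtain \<psi> where \<psi>: "eigenfunction G L (mu G L 2) \<psi>" "\<psi> p = 1" "\<forall>q\<in>graph_space G L. \<psi> q \<le> 1"
      using peak_at[OF p] by blast
    have "\<forall>q\<in>graph_ball G L p 1. \<psi> q \<le> \<psi> p"
      using \<psi> by (simp add: graph_ball_def)
    moreover have "\<psi> p \<noteq> 0" "\<forall>q\<in>graph_space G L. \<psi> q \<le> \<psi> p" using \<psi> by auto
    ultimately show ?thesis
      using p \<psi>(1) zero_less_one unfolding M_def M_loc_def by blast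
  qed
  moreover have "M G L \<subseteq> graph_space G L" "M_loc G L \<subseteq> graph_space G L"
    by (auto simp: M_def M_loc_def)
  ultimately show ?thesis by blast
qed

text \<open>Common scheme for both families: for nonpositive eigenvalues the energy identity
  applies, and an eigenvalue \<open>k^2\<close> with \<open>0 < k < \<kappa>\<close> would have a
  nonzero eigenfunction vanishing at all vertices.\<close>

lemma small_eigenfunction_constant:
  assumes "0 < \<kappa>"
    and vanish: "\<And>k \<phi> v. eigenfunction G L (k\<^sup>2) \<phi> \<Longrightarrow> 0 < k \<Longrightarrow> k < \<kappa> \<Longrightarrow> v \<in> verts G \<Longrightarrow> \<phi> (Vertex v) = 0"
    and sin: "\<And>k e. 0 < k \<Longrightarrow> k < \<kappa> \<Longrightarrow> e \<in> arcs G \<Longrightarrow> sin (k * L e) \<noteq> 0"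
    and \<phi>: "eigenfunction G L \<nu> \<phi>" "\<nu> < \<kappa>\<^sup>2"
  shows "\<exists>c. \<forall>p\<in>graph_space G L. \<phi> p = c"
proof (cases "\<nu> \<le> 0")
  case True
  then show ?thesis
    using nonpositive_eigenfunction_constant[OF \<phi>(1)] by metis
next
  case False
  define k where "k = sqrt \<nu>"
  have k: "k\<^sup>2 = \<nu>" "0 < k" "k < \<kappa>"
    using False \<phi>(2) \<open>0 < \<kappa>\<close> by (simp_all add: k_def real_less_lsqrt)
  have "eigenfunction G L (k\<^sup>2) \<phi>" using \<phi>(1) k(1) by simp
  then have False
    using no_eigenfunction_vanishing_on_vertices[of k \<phi>] vanish sin k(2,3) by blast
  then show ?thesis ..
qed

end

section \<open>Pumpkin graphs and complete graphs\<close>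

text \<open>If \<open>cos (\<kappa> * l) = - 1 / n\<close>, the form
  \<open>p^2 + q^2 + 2 p q / n\<close> is the squared amplitude of the sinusoid with end values
  \<open>p\<close> and \<open>q\<close>, times the squared sine of \<open>\<kappa> * l\<close>.
  Replacing \<open>q\<close> by \<open>r\<close> does not increase it: the difference is
  \<open>(q - r) (q + r + 2 p / n)\<close>, and both factors are nonnegative multiples of
  \<open>p + n q\<close>.\<close>

lemma amplitude_bound_adjacent:
  fixes n p q r :: real
  assumes n: "n \<ge> 2" and r: "r * (n - 1) = - (p + q)"
  shows "p\<^sup>2 + r\<^sup>2 + 2 * p * r / n \<le> p\<^sup>2 + q\<^sup>2 + 2 * p * q / n"
proof -
  have "(n * (n - 1)\<^sup>2) * ((q - r) * (q + r + 2 * p / n)) = ((n - 1) * (q - r)) * (n * (n - 1) * (q + r + 2 * p / n))"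
    by (simp add: power2_eq_square)
  also have "(n - 1) * (q - r) = p + n * q"
    using r by (simp add: algebra_simps)
  also have "n * (n - 1) * (q + r + 2 * p / n) = n * (n - 1) * q + n * (r * (n - 1)) + 2 * (n - 1) * p"
    using n by (simp add: field_simps)
  also have "\<dots> = (n - 2) * (p + n * q)"
    unfolding r by (simp add: algebra_simps)
  finally have "(n * (n - 1)\<^sup>2) * ((q - r) * (q + r + 2 * p / n)) = (n - 2) * (p + n * q)\<^sup>2"
    by (simp add: power2_eq_square)
  moreover have "(n - 2) * (p + n * q)\<^sup>2 \<ge> 0"
    using n by simp
  moreover have "n * (n - 1)\<^sup>2 > 0"
    using n by simp
  ultimately have "(q - r) * (q + r + 2 * p / n) \<ge> 0"
    by (metis zero_le_mult_iff not_less)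
  then show ?thesis
    by (simp add: algebra_simps power2_eq_square diff_divide_distrib)
qed

text \<open>The bound for an edge with value \<open>r\<close> at both ends; such an edge requires
  four vertices, hence \<open>n \<ge> 3\<close>. Diagonalising the form in \<open>p + q\<close> and
  \<open>p - q\<close> bounds \<open>(p + q)^2\<close>, and \<open>n - 1 \<ge> 2\<close> passes the
  bound on to \<open>r\<close>.\<close>

lemma amplitude_bound_opposite:
  fixes n p q r :: real
  assumes n: "n \<ge> 3" and r: "r * (n - 1) = - (p + q)"
    and pq: "p\<^sup>2 + q\<^sup>2 + 2 * p * q / n = 1 - 1 / n\<^sup>2"
  shows "r\<^sup>2 + r\<^sup>2 + 2 * r * r / n \<le> 1 - 1 / n\<^sup>2"
proof -
  have "(1 + 1 / n) * (p + q)\<^sup>2 + (1 - 1 / n) * (p - q)\<^sup>2 = 2 * (p\<^sup>2 + q\<^sup>2 + 2 * p * q / n)"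
    by (simp add: power2_eq_square algebra_simps)
  also have "\<dots> = (1 + 1 / n) * (2 * (1 - 1 / n))"
    unfolding pq by (simp add: power2_eq_square algebra_simps add_divide_distrib)
  finally have "(1 + 1 / n) * (p + q)\<^sup>2 + (1 - 1 / n) * (p - q)\<^sup>2 = (1 + 1 / n) * (2 * (1 - 1 / n))" .
  moreover have "(1 - 1 / n) * (p - q)\<^sup>2 \<ge> 0"
    using n by simp
  ultimately have "(1 + 1 / n) * (p + q)\<^sup>2 \<le> (1 + 1 / n) * (2 * (1 - 1 / n))"
    by linarith
  moreover have pos: "1 + 1 / n > 0" using n by (simp add: add_pos_pos)
  ultimately have "(p + q)\<^sup>2 \<le> 2 * (1 - 1 / n)"
    by (simp only: mult_le_cancel_left_pos)
  moreover have "(p + q)\<^sup>2 = r\<^sup>2 * (n - 1)\<^sup>2"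
    using r by (metis power2_minus power_mult_distrib)
  ultimately have upper: "r\<^sup>2 * (n - 1)\<^sup>2 \<le> 2 * (1 - 1 / n)" by simp
  have "r\<^sup>2 * 4 \<le> r\<^sup>2 * (n - 1)\<^sup>2"
  proof (rule mult_left_mono)
    have "2\<^sup>2 \<le> (n - 1)\<^sup>2" using n by (intro power_mono) auto
    then show "4 \<le> (n - 1)\<^sup>2" by simp
  qed simp
  from order_trans[OF this upper] have "2 * r\<^sup>2 \<le> 1 - 1 / n" by simp
  then have "(1 + 1 / n) * (2 * r\<^sup>2) \<le> (1 + 1 / n) * (1 - 1 / n)"
    using pos by (intro mult_left_mono) auto
  then show ?thesis
    by (simp add: power2_eq_square algebra_simps)
qed

context metric_graph
begin

section \<open>Pumpkin graphs\<close>

lemma pumpkin_ends: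
  assumes "pumpkin_graph G" "v \<in> verts G" "e \<in> arcs G"
  shows "tail G e = v \<longleftrightarrow> head G e \<noteq> v"
  using assms unfolding pumpkin_graph_def by (auto simp: doubleton_eq_iff)

lemma pumpkin_incident_arcs:
  assumes "pumpkin_graph G" "v \<in> verts G"
  shows "in_arcs G v \<union> out_arcs G v = arcs G" "in_arcs G v \<inter> out_arcs G v = {}"
  using pumpkin_ends[OF assms] by auto

lemma pumpkin_degree:
  assumes "pumpkin_graph G" "v \<in> verts G"
  shows "in_degree G v + out_degree G v = card (arcs G)"
  using card_Un_disjoint[of "in_arcs G v" "out_arcs G v"] pumpkin_incident_arcs[OF assms]
  by (simp add: in_degree_def out_degree_def finite_in_arcs finite_out_arcs)

lemma pumpkin_neighbour_sum:
  assumes "pumpkin_graph G" and v: "v \<in> verts G" and w: "w \<in> verts G" and "v \<noteq> w"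
  shows "neighbour_sum a v = real (card (arcs G)) * a w"
proof -
  obtain v1 v2 where "verts G = {v1, v2}"
    using assms(1) unfolding pumpkin_graph_def by blast
  then have other: "x = w" if "x \<in> verts G" "x \<noteq> v" for x
    using that v w \<open>v \<noteq> w\<close> by auto
  have "tail G e = w" if "e \<in> in_arcs G v" for e
    using that pumpkin_ends[OF assms(1) v, of e] other[of "tail G e"] by auto
  moreover have "head G e = w" if "e \<in> out_arcs G v" for e
    using that pumpkin_ends[OF assms(1) v, of e] other[of "head G e"] by auto
  ultimately have "neighbour_sum a v = real (in_degree G v) * a w + real (out_degree G v) * a w"
    by (simp add: neighbour_sum_def in_degree_def out_degree_def)
  also have "\<dots> = real (in_degree G v + out_degree G v) * a w"
    by (simp add: algebra_simps)
  finally show ?thesis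
    unfolding pumpkin_degree[OF assms(1) v] .
qed

lemma M_pumpkin:
  assumes pumpkin: "pumpkin_graph G" and len: "\<And>e. e \<in> arcs G \<Longrightarrow> L e = l"
  shows "M G L = M_loc G L \<and> M_loc G L = graph_space G L"
proof -
  define N where "N = card (arcs G)"
  have N: "N \<ge> 2"
    using pumpkin by (simp add: pumpkin_graph_def N_def)
  then have "arcs G \<noteq> {}"
    by (auto simp: N_def)
  then have l: "l > 0"
    using len length_pos by fastforce
  define \<kappa> where "\<kappa> = pi / l"
  have \<kappa>: "\<kappa> > 0" "\<kappa> * l = pi"
    using l by (simp_all add: \<kappa>_def)
  have sin_pos: "sin (k * l) > 0" if "0 < k" "k < \<kappa>" for k
  proof (rule sin_gt_zero)
    show "0 < k * l" using that l by simp
    show "k * l < pi" using mult_strict_right_mono[OF that(2) l] \<kappa>(2) by simp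
  qed
  have vanish: "\<phi> (Vertex v) = 0"
    if \<phi>: "eigenfunction G L (k\<^sup>2) \<phi>" and k: "0 < k" "k < \<kappa>" and v: "v \<in> verts G" for k \<phi> v
  proof -
    let ?c = "cos (k * l)"
    obtain w where w: "w \<in> verts G" "v \<noteq> w"
      using pumpkin v unfolding pumpkin_graph_def by auto
    \<comment> \<open>The vertex equations exchange the two values up to the factor
      \<open>?c\<close>. Used together they force \<open>?c^2 = 1\<close> unless the value is zero,
      and the sine is not zero.\<close>
    have "?c * \<phi> (Vertex v) = \<phi> (Vertex w)"
      using eigenfunction_vertex_equation[OF \<phi> k(1) v len] N
      unfolding pumpkin_neighbour_sum[OF pumpkin v w] pumpkin_degree[OF pumpkin v] N_def[symmetric]
      by simp
    moreover have "?c * \<phi> (Vertex w) = \<phi> (Vertex v)"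
      using eigenfunction_vertex_equation[OF \<phi> k(1) w(1) len] N
      unfolding pumpkin_neighbour_sum[OF pumpkin w(1) v w(2)[symmetric]] pumpkin_degree[OF pumpkin w(1)]
        N_def[symmetric]
      by simp
    ultimately have "?c * (?c * \<phi> (Vertex v)) = \<phi> (Vertex v)"
      by simp
    then have "\<phi> (Vertex v) * (sin (k * l))\<^sup>2 = 0"
      unfolding sin_squared_eq by (simp add: algebra_simps power2_eq_square)
    then show ?thesis
      using sin_pos[OF k] by simp
  qed
  show ?thesis
  proof (rule M_eq_M_loc_eq_graph_space)
    show "\<kappa>\<^sup>2 > 0" using \<kappa> by simp
  next
    fix v assume v: "v \<in> verts G"
    obtain e where "e \<in> arcs G" using \<open>arcs G \<noteq> {}\<close> by blast
    then show "\<exists>e\<in>arcs G. v = tail G e \<or> v = head G e"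
      using pumpkin_ends[OF pumpkin v] by metis
  next
    fix \<nu> \<phi> assume \<phi>: "eigenfunction G L \<nu> \<phi>" "\<nu> < \<kappa>\<^sup>2"
    show "\<exists>c. \<forall>p\<in>graph_space G L. \<phi> p = c"
    proof (rule small_eigenfunction_constant[OF \<kappa>(1) _ _ \<phi>])
      show "\<phi>' (Vertex v) = 0"
        if "eigenfunction G L (k\<^sup>2) \<phi>'" "0 < k" "k < \<kappa>" "v \<in> verts G" for k \<phi>' v
        using that by (rule vanish)
      show "sin (k * L e) \<noteq> 0" if "0 < k" "k < \<kappa>" "e \<in> arcs G" for k e
        using sin_pos[OF that(1,2)] len[OF that(3)] by simp
    qed
  next
    fix e0 x0 assume e0: "e0 \<in> arcs G" and x0: "x0 \<in> {0..L e0}"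
    \<comment> \<open>On \<open>e0\<close> the function \<open>cos (\<kappa> * (x - x0))\<close> has
      tail value \<open>cos (\<kappa> * x0)\<close> and sine coefficient \<open>s\<close>; an edge
      is half a wave, which flips the sign at the other vertex.\<close>
    define s where "s = sin (\<kappa> * x0)"
    define a where "a v = (if v = tail G e0 then cos (\<kappa> * x0) else - cos (\<kappa> * x0))" for v
    \<comment> \<open>The other \<open>N - 1\<close> edges share \<open>- s\<close> equally, so that
      all coefficients sum to zero. Over half a wave the derivatives into an edge from its two ends
      agree, so orientations do not matter and this one sum is the Kirchhoff condition at both
      vertices.\<close>
    define b where "b e = (if e = e0 then s else - s / (real N - 1))" for e
    let ?\<psi> = "trig_function \<kappa> a b"
    have ends: "a (head G e) = a (tail G e) * cos (\<kappa> * L e) + b e * sin (\<kappa> * L e)" if e: "e \<in> arcs G" for e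
      using pumpkin_ends[OF pumpkin tail_in_verts[OF e0] e] \<kappa>(2) len[OF e] by (auto simp: a_def)
    note edge = on_edge_trig_function[of a _ \<kappa> b, OF ends]
    have "sum b (arcs G) = s + (\<Sum>e\<in>arcs G - {e0}. - s / (real N - 1))"
      using e0 by (simp add: sum.remove[of _ e0] b_def)
    also have "\<dots> = 0"
      using N e0 by (simp add: N_def[symmetric] card_Diff_singleton of_nat_diff)
    finally have sum_b: "sum b (arcs G) = 0" .
    have peak_value: "on_edge G L ?\<psi> e0 x0 = 1"
      unfolding edge[OF e0] using sin_cos_squared_add3[of "\<kappa> * x0"]
      by (simp add: a_def b_def s_def)
    have "eigenfunction G L (\<kappa>\<^sup>2) ?\<psi>"
    proof (rule eigenfunction_trig_function[OF ends])
      fix v assume v: "v \<in> verts G"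
      have "(\<Sum>e\<in>in_arcs G v. b e * cos (\<kappa> * L e) - a (tail G e) * sin (\<kappa> * L e)) = (\<Sum>e\<in>in_arcs G v. - b e)"
        by (rule sum.cong) (auto simp: len \<kappa>(2))
      moreover have "sum b (in_arcs G v) + sum b (out_arcs G v) = 0"
        using sum.union_disjoint[of "in_arcs G v" "out_arcs G v" b] pumpkin_incident_arcs[OF pumpkin v] sum_b
        by (simp add: finite_in_arcs finite_out_arcs)
      ultimately show "(\<Sum>e\<in>in_arcs G v. b e * cos (\<kappa> * L e) - a (tail G e) * sin (\<kappa> * L e)) = sum b (out_arcs G v)"
        by (simp add: sum_negf)
    next
      show "\<exists>p\<in>graph_space G L. ?\<psi> p \<noteq> 0"
        using peak_value edge_point_in_graph_space[OF e0 x0] by (intro bexI) (auto simp: on_edge_def)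
    qed
    moreover have "on_edge G L ?\<psi> e y \<le> 1" if e: "e \<in> arcs G" for e y
      unfolding edge[OF e]
    proof (rule trig_le_1)
      \<comment> \<open>No coefficient exceeds that of \<open>e0\<close>, where the amplitude is 1;
        for the shared one this uses \<open>N \<ge> 2\<close>.\<close>
      have "(b e)\<^sup>2 \<le> s\<^sup>2"
      proof (cases "e = e0")
        case False
        have "1 \<le> (real N - 1)\<^sup>2" using N by (simp add: power2_eq_square mult_ge1_I)
        then have "s\<^sup>2 / (real N - 1)\<^sup>2 \<le> s\<^sup>2 / 1"
          by (intro divide_left_mono) auto
        then show ?thesis using False by (simp add: b_def power_divide)
      qed (simp add: b_def)
      moreover have "(a (tail G e))\<^sup>2 = (cos (\<kappa> * x0))\<^sup>2" by (simp add: a_def)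
      moreover have "(cos (\<kappa> * x0))\<^sup>2 + s\<^sup>2 = 1" by (simp add: s_def)
      ultimately show "(a (tail G e))\<^sup>2 + (b e)\<^sup>2 \<le> 1" by linarith
    qed
    ultimately show "\<exists>\<psi>. eigenfunction G L (\<kappa>\<^sup>2) \<psi> \<and> on_edge G L \<psi> e0 x0 = 1 \<and>
        (\<forall>e'\<in>arcs G. \<forall>y\<in>{0..L e'}. on_edge G L \<psi> e' y \<le> 1)"
      using peak_value by blast
  qed
qed

section \<open>Complete graphs\<close>

text \<open>The chosen edges from \<open>v\<close> to the other vertices are distinct, and their
  number already equals the degree. A loop would count twice in the degree, so there is none, and
  the chosen edges are all the edges at \<open>v\<close>.\<close>

lemma complete_graph_incidence:
  assumes complete: "complete_graph G" and v: "v \<in> verts G"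
  shows "in_arcs G v \<inter> out_arcs G v = {}"
    and "neighbour_sum a v = sum a (verts G - {v})"
proof -
  let ?I = "in_arcs G v" and ?O = "out_arcs G v" and ?W = "verts G - {v}"
  have fin: "finite ?I" "finite ?O" "finite ?W"
    by (simp_all add: finite_in_arcs finite_out_arcs)
  have "\<forall>w\<in>?W. \<exists>e. e \<in> arcs G \<and> {tail G e, head G e} = {v, w}"
    using complete v unfolding complete_graph_def by blast
  then obtain E where E: "\<And>w. w \<in> ?W \<Longrightarrow> E w \<in> arcs G \<and> {tail G (E w), head G (E w)} = {v, w}"
    by metis
  have inj: "inj_on E ?W"
  proof (rule inj_onI)
    fix w w' assume "w \<in> ?W" "w' \<in> ?W" "E w = E w'"
    then have "{v, w} = {v, w'}" using E by metis
    then show "w = w'" by (auto simp: doubleton_eq_iff)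
  qed
  have sub: "E ` ?W \<subseteq> ?I \<union> ?O"
  proof
    fix e assume "e \<in> E ` ?W"
    then obtain w where "w \<in> ?W" "e = E w" by blast
    then show "e \<in> ?I \<union> ?O" using E[of w] by (auto simp: doubleton_eq_iff)
  qed
  have cardW: "card ?W = card (verts G) - 1"
    using v by (simp add: card_Diff_singleton)
  have "card ?I + card ?O = card (verts G) - 1"
    using complete v by (simp add: complete_graph_def in_degree_def out_degree_def)
  then have count: "card (?I \<union> ?O) + card (?I \<inter> ?O) = card (E ` ?W)"
    using card_Un_Int[OF fin(1,2)] card_image[OF inj] cardW by simp
  moreover have "card (E ` ?W) \<le> card (?I \<union> ?O)"
    using sub fin by (intro card_mono) auto
  ultimately have "card (?I \<inter> ?O) = 0" and cardE: "card (E ` ?W) = card (?I \<union> ?O)"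
    by linarith+
  then show disj: "?I \<inter> ?O = {}"
    using fin by simp
  have image: "E ` ?W = ?I \<union> ?O"
    using sub cardE fin by (intro card_subset_eq) auto
  \<comment> \<open>The end opposite \<open>v\<close>, which treats incoming and outgoing arcs
    alike.\<close>
  define other where "other e = (if head G e = v then tail G e else head G e)" for e
  have "neighbour_sum a v = (\<Sum>e\<in>?I. a (other e)) + (\<Sum>e\<in>?O. a (other e))"
  proof -
    have "(\<Sum>e\<in>?I. a (tail G e)) = (\<Sum>e\<in>?I. a (other e))"
      by (rule sum.cong) (auto simp: other_def)
    moreover have "(\<Sum>e\<in>?O. a (head G e)) = (\<Sum>e\<in>?O. a (other e))"
      using disj by (intro sum.cong) (auto simp: other_def)
    ultimately show ?thesis by (simp add: neighbour_sum_def)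
  qed
  also have "\<dots> = (\<Sum>e\<in>E ` ?W. a (other e))"
    unfolding image using fin disj by (simp add: sum.union_disjoint)
  also have "\<dots> = (\<Sum>w\<in>?W. a (other (E w)))"
    using sum.reindex[OF inj] by simp
  also have "\<dots> = sum a ?W"
  proof (rule sum.cong)
    fix w assume "w \<in> ?W"
    then have "other (E w) = w"
      using E[of w] by (auto simp: other_def doubleton_eq_iff)
    then show "a (other (E w)) = a w" by simp
  qed simp
  finally show "neighbour_sum a v = sum a ?W" .
qed

lemma complete_graph_neighbour_sum:
  assumes "complete_graph G" "v \<in> verts G"
  shows "neighbour_sum a v = sum a (verts G) - a v"
  using complete_graph_incidence(2)[OF assms, of a] assms(2) by (simp add: sum_diff1)

lemma complete_graph_no_loops:
  assumes "complete_graph G" "e \<in> arcs G"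
  shows "tail G e \<noteq> head G e"
  using complete_graph_incidence(1)[OF assms(1) tail_in_verts[OF assms(2)]] assms(2) by auto

lemma M_complete:
  assumes complete: "complete_graph G" and V: "card (verts G) \<ge> 3" and len: "\<And>e. e \<in> arcs G \<Longrightarrow> L e = l"
  shows "M G L = M_loc G L \<and> M_loc G L = graph_space G L"
proof -
  \<comment> \<open>The common degree; the number of vertices is \<open>n + 1\<close>.\<close>
  define n where "n = real (card (verts G)) - 1"
  have n: "n \<ge> 2" using V by (simp add: n_def)
  have degree: "real (in_degree G v + out_degree G v) = n" if "v \<in> verts G" for v
    using complete that V unfolding complete_graph_def n_def by (simp add: of_nat_diff)
  have cover: "\<exists>e\<in>arcs G. v = tail G e \<or> v = head G e" if v: "v \<in> verts G" for v
  proof (rule ccontr)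
    assume "\<not> ?thesis"
    then have "in_arcs G v = {}" "out_arcs G v = {}" by auto
    then show False using degree[OF v] n by (simp add: in_degree_def out_degree_def)
  qed
  have "verts G \<noteq> {}" using V by auto
  then obtain e1 where e1: "e1 \<in> arcs G" using cover by blast
  have l: "l > 0" using len[OF e1] length_pos[OF e1] by simp
  \<comment> \<open>The first frequency with \<open>n * cos (k * l) = - 1\<close>, where the vertex
    equations admit every assignment of values with total zero.\<close>
  define \<kappa> where "\<kappa> = arccos (- 1 / n) / l"
  have range: "- 1 < - 1 / n" "- 1 / n < 1" using n by (simp_all add: field_simps)
  have \<kappa>l: "\<kappa> * l = arccos (- 1 / n)" using l by (simp add: \<kappa>_def)
  have arc: "0 < arccos (- 1 / n)" "arccos (- 1 / n) < pi"
    using arccos_lt_bounded[of "- 1 / n"] range by auto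
  have \<kappa>: "\<kappa> > 0" using arc(1) l by (simp add: \<kappa>_def)
  have c: "cos (\<kappa> * l) = - 1 / n"
    unfolding \<kappa>l by (rule cos_arccos) (use range in auto)
  have s_pos: "sin (\<kappa> * l) > 0"
    unfolding \<kappa>l by (rule sin_gt_zero) (use arc in auto)
  have s2: "(sin (\<kappa> * l))\<^sup>2 = 1 - 1 / n\<^sup>2"
    unfolding sin_squared_eq c by (simp add: power_divide)
  have kl: "0 < k * l" "k * l < \<kappa> * l" if "0 < k" "k < \<kappa>" for k
    using that l by simp_all
  have sin_pos: "sin (k * l) > 0" if "0 < k" "k < \<kappa>" for k
    using kl[OF that] arc \<kappa>l by (intro sin_gt_zero) auto
  have vanish: "\<phi> (Vertex v) = 0"
    if \<phi>: "eigenfunction G L (k\<^sup>2) \<phi>" and k: "0 < k" "k < \<kappa>" and v: "v \<in> verts G" for k \<phi> v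
  proof -
    let ?c = "cos (k * l)" and ?a = "\<lambda>w. \<phi> (Vertex w)"
    let ?S = "sum ?a (verts G)"
    have eq: "(n * ?c + 1) * ?a w = ?S" if w: "w \<in> verts G" for w
      using eigenfunction_vertex_equation[OF \<phi> k(1) w len]
      unfolding complete_graph_neighbour_sum[OF complete w] degree[OF w]
      by (simp add: algebra_simps)
    \<comment> \<open>Summing the vertex equations over all \<open>n + 1\<close> vertices isolates
      the total \<open>?S\<close>. Once it vanishes, each equation reads
      \<open>(n * ?c + 1) * ?a w = 0\<close>.\<close>
    have "(n * ?c + 1) * ?S = (\<Sum>w\<in>verts G. ?S)"
      unfolding sum_distrib_left by (rule sum.cong) (use eq in auto)
    then have "(n * ?c + 1) * ?S = (n + 1) * ?S"
      by (simp add: n_def)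
    then have "n * (?S * (1 - ?c)) = 0"
      by algebra
    moreover have "?c \<noteq> 1"
      using sin_pos[OF k] sin_squared_eq[of "k * l"] by auto
    ultimately have "?S = 0"
      using n by simp
    moreover have "?c > cos (\<kappa> * l)"
      using kl[OF k] arc \<kappa>l by (intro cos_monotone_0_pi) auto
    then have "n * ?c + 1 > 0"
      using n unfolding c by (simp add: field_simps)
    ultimately show ?thesis
      using eq[OF v] by simp
  qed
  show ?thesis
  proof (rule M_eq_M_loc_eq_graph_space)
    show "\<kappa>\<^sup>2 > 0" using \<kappa> by simp
  next
    fix v assume "v \<in> verts G"
    then show "\<exists>e\<in>arcs G. v = tail G e \<or> v = head G e" by (rule cover)
  next
    fix \<nu> \<phi> assume \<phi>: "eigenfunction G L \<nu> \<phi>" "\<nu> < \<kappa>\<^sup>2"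
    show "\<exists>c. \<forall>p\<in>graph_space G L. \<phi> p = c"
    proof (rule small_eigenfunction_constant[OF \<kappa> _ _ \<phi>])
      show "\<phi>' (Vertex v) = 0"
        if "eigenfunction G L (k\<^sup>2) \<phi>'" "0 < k" "k < \<kappa>" "v \<in> verts G" for k \<phi>' v
        using that by (rule vanish)
      show "sin (k * L e) \<noteq> 0" if "0 < k" "k < \<kappa>" "e \<in> arcs G" for k e
        using sin_pos[OF that(1,2)] len[OF that(3)] by simp
    qed
  next
    fix e0 x0 assume e0: "e0 \<in> arcs G" and x0: "x0 \<in> {0..L e0}"
    define u w where "u = tail G e0" and "w = head G e0"
    have uw: "u \<in> verts G" "w \<in> verts G" "u \<noteq> w"
      using complete_graph_no_loops[OF complete e0] e0 by (auto simp: u_def w_def)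
    \<comment> \<open>\<open>p\<close> and \<open>q\<close> are the end values of
      \<open>cos (\<kappa> * (x - x0))\<close> on \<open>e0\<close>; the other \<open>n - 1\<close>
      vertices share the value \<open>r\<close> that makes the total zero.\<close>
    define p where "p = cos (\<kappa> * x0)"
    define q where "q = cos (\<kappa> * (l - x0))"
    define r where "r = - (p + q) / (n - 1)"
    have r: "r * (n - 1) = - (p + q)" using n by (simp add: r_def)
    define a where "a v = (if v = u then p else if v = w then q else r)" for v
    let ?c = "cos (\<kappa> * l)" and ?s = "sin (\<kappa> * l)"
    \<comment> \<open>The sine coefficient that produces the prescribed value at the head.\<close>
    define b where "b e = (a (head G e) - a (tail G e) * ?c) / ?s" for e
    let ?\<psi> = "trig_function \<kappa> a b"
    have q: "q = ?c * p + ?s * sin (\<kappa> * x0)"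
      by (simp add: q_def p_def right_diff_distrib cos_diff)
    have b0: "b e0 = sin (\<kappa> * x0)"
      using s_pos uw(3) unfolding b_def u_def[symmetric] w_def[symmetric] by (simp add: a_def q)
    have ends: "a (head G e) = a (tail G e) * cos (\<kappa> * L e) + b e * sin (\<kappa> * L e)" if e: "e \<in> arcs G" for e
      using s_pos len[OF e] by (simp add: b_def)
    note edge = on_edge_trig_function[of a _ \<kappa> b, OF ends]
    have peak_value: "on_edge G L ?\<psi> e0 x0 = 1"
      unfolding edge[OF e0] b0 using sin_cos_squared_add3[of "\<kappa> * x0"]
      by (simp add: a_def u_def[symmetric] p_def)
    have sum_a: "sum a (verts G) = 0"
    proof -
      have "sum a (verts G) = a u + (a w + sum a (verts G - {u} - {w}))"
        using uw by (simp add: sum.remove[of _ u] sum.remove[of _ w])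
      also have "sum a (verts G - {u} - {w}) = (\<Sum>v\<in>verts G - {u} - {w}. r)"
        by (rule sum.cong) (auto simp: a_def)
      also have "\<dots> = (n - 1) * r"
        using uw V by (simp add: card_Diff_singleton n_def of_nat_diff)
      finally show ?thesis
        using r uw(3) by (simp add: a_def mult.commute)
    qed
    have "eigenfunction G L (\<kappa>\<^sup>2) ?\<psi>"
    proof (rule eigenfunction_trig_function[OF ends])
      fix v assume v: "v \<in> verts G"
      \<comment> \<open>The derivative at the head without the factor \<open>\<kappa>\<close>,
        expressed by the two end values.\<close>
      have "b e * ?c - a (tail G e) * ?s = (a (head G e) * ?c - a (tail G e)) / ?s" for e
      proof -
        have "?s * (b e * ?c - a (tail G e) * ?s) = (?s * b e) * ?c - a (tail G e) * ?s\<^sup>2"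
          by algebra
        also have "?s * b e = a (head G e) - a (tail G e) * ?c"
          using s_pos by (simp add: b_def)
        also have "(a (head G e) - a (tail G e) * ?c) * ?c - a (tail G e) * ?s\<^sup>2 =
            a (head G e) * ?c - a (tail G e) * (?s\<^sup>2 + ?c\<^sup>2)"
          by algebra
        finally show ?thesis
          using s_pos by (simp add: field_simps)
      qed
      then have "(\<Sum>e\<in>in_arcs G v. b e * cos (\<kappa> * L e) - a (tail G e) * sin (\<kappa> * L e)) =
          (\<Sum>e\<in>in_arcs G v. (a v * ?c - a (tail G e)) / ?s)"
        by (intro sum.cong) (auto simp: len)
      also have "\<dots> = (real (in_degree G v) * (a v * ?c) - (\<Sum>e\<in>in_arcs G v. a (tail G e))) / ?s"
        unfolding sum_divide_distrib[symmetric] sum_subtractf by (simp add: in_degree_def)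
      finally have inward: "(\<Sum>e\<in>in_arcs G v. b e * cos (\<kappa> * L e) - a (tail G e) * sin (\<kappa> * L e)) =
          (real (in_degree G v) * (a v * ?c) - (\<Sum>e\<in>in_arcs G v. a (tail G e))) / ?s" .
      have "sum b (out_arcs G v) = (\<Sum>e\<in>out_arcs G v. (a (head G e) - a v * ?c) / ?s)"
        by (rule sum.cong) (auto simp: b_def)
      also have "\<dots> = ((\<Sum>e\<in>out_arcs G v. a (head G e)) - real (out_degree G v) * (a v * ?c)) / ?s"
        unfolding sum_divide_distrib[symmetric] sum_subtractf by (simp add: out_degree_def)
      finally have outward: "sum b (out_arcs G v) =
          ((\<Sum>e\<in>out_arcs G v. a (head G e)) - real (out_degree G v) * (a v * ?c)) / ?s" .
      \<comment> \<open>Since the total is zero, the neighbours of \<open>v\<close> sum to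
        \<open>- a v\<close>, and \<open>n * ?c = - 1\<close>.\<close>
      have "real (in_degree G v + out_degree G v) * (a v * ?c) = neighbour_sum a v"
        unfolding complete_graph_neighbour_sum[OF complete v] sum_a degree[OF v] c using n by simp
      then have "real (in_degree G v) * (a v * ?c) - (\<Sum>e\<in>in_arcs G v. a (tail G e)) =
          (\<Sum>e\<in>out_arcs G v. a (head G e)) - real (out_degree G v) * (a v * ?c)"
        unfolding neighbour_sum_def by (simp add: algebra_simps)
      then show "(\<Sum>e\<in>in_arcs G v. b e * cos (\<kappa> * L e) - a (tail G e) * sin (\<kappa> * L e)) = sum b (out_arcs G v)"
        unfolding inward outward by simp
    next
      show "\<exists>p\<in>graph_space G L. ?\<psi> p \<noteq> 0"
        using peak_value edge_point_in_graph_space[OF e0 x0] by (intro bexI) (auto simp: on_edge_def)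
    qed
    moreover have "on_edge G L ?\<psi> e y \<le> 1" if e: "e \<in> arcs G" for e y
      unfolding edge[OF e]
    proof (rule trig_le_1)
      \<comment> \<open>The quadratic form of the amplitude inequalities; divided by the square of
        \<open>?s\<close> it is the squared amplitude on an edge.\<close>
      define amp where "amp x y = x\<^sup>2 + y\<^sup>2 + 2 * x * y / n" for x y :: real
      have amp_sym: "amp x y = amp y x" for x y by (simp add: amp_def)
      have amplitude: "(a (tail G e'))\<^sup>2 + (b e')\<^sup>2 = amp (a (tail G e')) (a (head G e')) / ?s\<^sup>2" for e'
      proof -
        have "?s\<^sup>2 * ((a (tail G e'))\<^sup>2 + (b e')\<^sup>2) = (a (tail G e'))\<^sup>2 * ?s\<^sup>2 + (?s * b e')\<^sup>2"
          by algebra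
        also have "?s * b e' = a (head G e') - a (tail G e') * ?c"
          using s_pos by (simp add: b_def)
        also have "(a (tail G e'))\<^sup>2 * ?s\<^sup>2 + (a (head G e') - a (tail G e') * ?c)\<^sup>2 =
            (a (tail G e'))\<^sup>2 * (?s\<^sup>2 + ?c\<^sup>2) + (a (head G e'))\<^sup>2 - 2 * a (tail G e') * a (head G e') * ?c"
          by algebra
        also have "\<dots> = amp (a (tail G e')) (a (head G e'))"
          by (simp add: amp_def c s2 power_divide)
        finally show ?thesis
          using s_pos by (simp add: field_simps)
      qed
      \<comment> \<open>On \<open>e0\<close> the coefficients are the cosine and sine of one angle,
        so the amplitude is 1.\<close>
      have "amp p q = ?s\<^sup>2"
        using amplitude[of e0] b0 uw(3) s_pos unfolding u_def[symmetric] w_def[symmetric]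
        by (simp add: a_def p_def)
      then have pq: "amp p q = 1 - 1 / n\<^sup>2"
        using s2 by simp
      have pr: "amp p r \<le> 1 - 1 / n\<^sup>2"
        using amplitude_bound_adjacent[OF n r] pq by (simp add: amp_def)
      have "r * (n - 1) = - (q + p)" using r by simp
      then have qr: "amp q r \<le> 1 - 1 / n\<^sup>2"
        using amplitude_bound_adjacent[OF n, of r q p] pq amp_sym[of p q] by (simp add: amp_def)
      let ?t = "tail G e" and ?h = "head G e"
      have th: "?t \<in> verts G" "?h \<in> verts G" "?t \<noteq> ?h"
        using complete_graph_no_loops[OF complete e] e by auto
      have "amp (a ?t) (a ?h) \<le> 1 - 1 / n\<^sup>2"
      \<comment> \<open>Either one end carries \<open>p\<close> or \<open>q\<close>, or the edge
        avoids \<open>u\<close> and \<open>w\<close>; then there are four distinct vertices, which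
        yields \<open>n \<ge> 3\<close>.\<close>
      proof (cases "?t \<in> {u, w} \<or> ?h \<in> {u, w}")
        case True
        then show ?thesis
          using th(3) uw(3) pq pr qr by (auto simp: a_def amp_sym[of q p] amp_sym[of r p] amp_sym[of r q])
      next
        case False
        then have "card {u, w, ?t, ?h} = 4"
          using uw(3) th(3) by auto
        moreover have "card {u, w, ?t, ?h} \<le> card (verts G)"
          using uw th by (intro card_mono) auto
        ultimately have "n \<ge> 3" by (simp add: n_def)
        then show ?thesis
          using amplitude_bound_opposite[OF _ r] pq False by (simp add: amp_def a_def)
      qed
      then show "(a ?t)\<^sup>2 + (b e)\<^sup>2 \<le> 1"
        unfolding amplitude s2[symmetric] using s_pos by simp
    qed
    ultimately show "\<exists>\<psi>. eigenfunction G L (\<kappa>\<^sup>2) \<psi> \<and> on_edge G L \<psi> e0 x0 = 1 \<and>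
        (\<forall>e'\<in>arcs G. \<forall>y\<in>{0..L e'}. on_edge G L \<psi> e' y \<le> 1)"
      using peak_value by blast
  qed
qed

end

theorem proposition4p2:
  fixes G :: "('v, 'e) pre_digraph" and L :: "'e \<Rightarrow> real"
  assumes "metric_graph G L"
    and "equilateral G L"
    and "pumpkin_graph G \<or> (complete_graph G \<and> card (verts G) \<ge> 3)"
  shows "M G L = M_loc G L \<and> M_loc G L = graph_space G L"
proof -
  interpret metric_graph G L by fact
  obtain l where "\<And>e. e \<in> arcs G \<Longrightarrow> L e = l"
    using assms(2) unfolding equilateral_def by metis
  then show ?thesis
    using assms(3) M_pumpkin M_complete by blast
qed

end
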